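(* Fix a constant $\Delta>0$. For each $n$ let ${\bf d}=(d_1,\ldots,d_n)$ be a degree sequence with $1\le d_i\le \Delta$ for all $1\le i\le n$, and let ${\mathcal G}({\bf d})$ be the uniformly random simple graph on vertex set $[n]$ with degree sequence ${\bf d}$. Let $n_j=|\{i: d_i=j\}|$. \begin{enumerate} \item[(a)] If $n_1=o(n^{1/2})$ and $n_2=o(n)$, then asymptotically almost surely ${\mathcal G}({\bf d})$ is asymmetric. \item[(b)] If $n_1=\omega(n^{1/2})$, then asymptotically almost surely ${\mathcal G}({\bf d})$ is symmetric. \item[(c)] If there is a constant $c>0$ such that $n_1>cn^{1/2}$ or $n_2>cn$, then there is $\delta=\delta(c)>0$ such that for all sufficiently large $n$, ${\mathbb P}({\mathcal G}({\bf d})\text{ is symmetric})>\delta$. \end{enumerate}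
   Context: Degree sequences are assumed graphical with even sum. A graph is asymmetric if its automorphism group contains only the identity permutation, and symmetric otherwise. Asymptotics are as $n\to\infty$; "asymptotically almost surely" (a.a.s.) means with probability tending to $1$. $a_n=o(b_n)$ means $a_n/b_n\to 0$; $a_n=\omega(b_n)$ means $b_n=o(a_n)$ and $a_n>0$ for all large $n$. *)

theory Defs
  imports
    "HOL-Probability.Probability"
    "HOL-Combinatorics.Permutations"
    "HOL-Library.Landau_Symbols"
begin

text \<open>A simple graph on the vertex set \<open>{1..n}\<close> is identified with its set of edges, each edge
  being a two-element set of vertices.\<close>

definition simple_graphs :: "nat \<Rightarrow> nat set set set" where
  "simple_graphs n = {E. \<forall>e\<in>E. e \<subseteq> {1..n} \<and> card e = 2}"

definition vertex_degree :: "nat set set \<Rightarrow> nat \<Rightarrow> nat" where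
  "vertex_degree E v = card {e \<in> E. v \<in> e}"

text \<open>A degree sequence of length \<open>n\<close> is a function of which only the values on \<open>{1..n}\<close> matter.\<close>

definition graphs_with_degrees :: "nat \<Rightarrow> (nat \<Rightarrow> nat) \<Rightarrow> nat set set set" where
  "graphs_with_degrees n d = {E \<in> simple_graphs n. \<forall>i\<in>{1..n}. vertex_degree E i = d i}"

definition graphical :: "nat \<Rightarrow> (nat \<Rightarrow> nat) \<Rightarrow> bool" where
  "graphical n d \<longleftrightarrow> graphs_with_degrees n d \<noteq> {}"

definition degree_count :: "nat \<Rightarrow> (nat \<Rightarrow> nat) \<Rightarrow> nat \<Rightarrow> nat" where
  "degree_count n d j = card {i \<in> {1..n}. d i = j}"

definition automorphisms :: "nat \<Rightarrow> nat set set \<Rightarrow> (nat \<Rightarrow> nat) set" where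
  "automorphisms n E = {p. p permutes {1..n} \<and> (\<lambda>e. p ` e) ` E = E}"

definition asymmetric_graph :: "nat \<Rightarrow> nat set set \<Rightarrow> bool" where
  "asymmetric_graph n E \<longleftrightarrow> automorphisms n E = {id}"

definition symmetric_graph :: "nat \<Rightarrow> nat set set \<Rightarrow> bool" where
  "symmetric_graph n E \<longleftrightarrow> \<not> asymmetric_graph n E"

lemma finite_simple_graphs: "finite (simple_graphs n)"
  by (rule finite_subset[of _ "Pow (Pow {1..n})"]) (auto simp: simple_graphs_def)

lemma finite_graphs_with_degrees: "finite (graphs_with_degrees n d)"
  using finite_simple_graphs by (simp add: graphs_with_degrees_def)

text \<open>By the preceding lemma, this is a genuine uniform distribution whenever \<open>graphical n d\<close>.\<close>

definition random_graph :: "nat \<Rightarrow> (nat \<Rightarrow> nat) \<Rightarrow> nat set set pmf" where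
  "random_graph n d = pmf_of_set (graphs_with_degrees n d)"

text \<open>Graphical sequences with all entries in \<open>{1..\<Delta>}\<close> do not exist for every \<open>n\<close>: never for
  \<open>n = 1\<close>, and for \<open>\<Delta> = 1\<close> only for even \<open>n\<close>. Hence \<open>n\<close> ranges over an arbitrary infinite set
  \<open>N\<close>, and \<open>n \<rightarrow> \<infinity>\<close> is understood within \<open>N\<close>. In particular \<open>N\<close> may consist of all
  sufficiently large \<open>n\<close>.\<close>

definition to_infinity_in :: "nat set \<Rightarrow> nat filter" where
  "to_infinity_in N = inf sequentially (principal N)"

text \<open>The even-sum condition is implied by graphicality; it is kept as part of the standing
  assumption.\<close>

definition bounded_degree_sequences :: "real \<Rightarrow> nat set \<Rightarrow> (nat \<Rightarrow> nat \<Rightarrow> nat) \<Rightarrow> bool" where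
  "bounded_degree_sequences \<Delta> N d \<longleftrightarrow>
     infinite N \<and>
     (\<forall>n\<in>N. graphical n (d n) \<and> even (\<Sum>i=1..n. d n i) \<and>
        (\<forall>i\<in>{1..n}. 1 \<le> d n i \<and> real (d n i) \<le> \<Delta>))"

end

theory Submission
  imports Defs "HOL-Combinatorics.Cycles" "HOL-Real_Asymp.Real_Asymp"
begin

text \<open>
  Everything is done by switchings \<open>u v, x y \<rightarrow> u x, v y\<close> on simple graphs with the given degrees. If
  no edge joins two leaves, a switching creates exactly one; comparing the numbers of choices in
  both directions shows that graphs without such an edge, whose ends can be swapped, are rare when
  there are many leaves. Three switchings likewise create a triangle component on three vertices of
  degree 2.

  For asymmetry, switchings show that a fixed set of \<open>k\<close> edges is present with probability at most
  \<open>(A / n)\<^sup>k\<close>. A symmetric graph has an automorphism \<open>f\<close> of prime order \<open>p\<close>; let \<open>S\<close> be its support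
  and \<open>a = |S|\<close>. The edges meeting \<open>S\<close> form a union of \<open>f\<close>-orbits of pairs, and almost all orbits have
  size \<open>p\<close>. Summing over such unions, with a factor \<open>r > 1\<close> for every edge end in \<open>S\<close> to exploit that
  there are \<open>\<Sum>s\<in>S. d s\<close> of these, bounds the probability that \<open>f\<close> is an automorphism by
  \<open>C\<^sup>a (\<Prod>s\<in>S. r powr - min (d s) 3)\<close>, where \<open>r\<^sup>2 = n / (A t)\<close> and \<open>t = a powr (1 / p)\<close>. At most
  \<open>(2 a / t)\<^sup>a\<close> permutations \<open>f\<close> have a given support, so the sum over all \<open>f\<close> is dominated by a
  geometric series in \<open>n\<^sub>1 / n powr (1/2) + n\<^sub>2 / n + n powr (-1/4)\<close>.
\<close>

section \<open>Switchings\<close>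

definition nbrs :: "nat set set \<Rightarrow> nat \<Rightarrow> nat set" where
  "nbrs G v = {w. {v, w} \<in> G}"

definition arcs :: "nat set set \<Rightarrow> (nat \<times> nat) set" where
  "arcs G = {(x, y). {x, y} \<in> G}"

text \<open>The order of the arguments fixes which ends are rejoined. With this convention the
  inverse switching is obtained by exchanging the two middle arguments.\<close>

definition switch :: "nat set set \<Rightarrow> nat \<Rightarrow> nat \<Rightarrow> nat \<Rightarrow> nat \<Rightarrow> nat set set" where
  "switch G u v x y = G - {{u, v}, {x, y}} \<union> {{u, x}, {v, y}}"

text \<open>The comparison behind every switching argument. Here \<open>f x\<close> collects the
  switchings available at \<open>x\<close>, \<open>g y\<close> the data from which a switching that
  led to \<open>y\<close> may be undone, and \<open>h\<close> sends a switching to its outcome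
  together with such data. The data in \<open>g y\<close> may include some that arise from no
  switching.\<close>

lemma double_counting:
  fixes k l :: nat
  assumes "finite A" "finite B"
    and "\<And>x. x \<in> A \<Longrightarrow> finite (f x) \<and> k \<le> card (f x)"
    and "\<And>y. y \<in> B \<Longrightarrow> finite (g y) \<and> card (g y) \<le> l"
    and "inj_on h (Sigma A f)" "h ` Sigma A f \<subseteq> Sigma B g"
  shows "k * card A \<le> l * card B"
proof -
  have "k * card A = (\<Sum>x\<in>A. k)" by simp
  also have "\<dots> \<le> (\<Sum>x\<in>A. card (f x))"
    using assms(3) by (intro sum_mono) auto
  also have "\<dots> = card (Sigma A f)"
    using assms(1,3) by (subst card_SigmaI) auto
  also have "\<dots> \<le> card (Sigma B g)"
    using assms by (intro card_inj_on_le[of h]) auto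
  also have "\<dots> = (\<Sum>y\<in>B. card (g y))"
    using assms(2,4) by (subst card_SigmaI) auto
  also have "\<dots> \<le> (\<Sum>y\<in>B. l)"
    using assms(4) by (intro sum_mono) auto
  finally show ?thesis by (simp add: mult.commute)
qed

lemma simple_graphs_finite: "G \<in> simple_graphs n \<Longrightarrow> finite G"
  by (rule finite_subset[of _ "Pow {1..n}"]) (auto simp: simple_graphs_def)

lemma simple_graphs_edgeD:
  assumes "G \<in> simple_graphs n" "{u, v} \<in> G"
  shows "u \<noteq> v" "u \<in> {1..n}" "v \<in> {1..n}"
proof -
  have "card {u, v} = 2" "{u, v} \<subseteq> {1..n}" using assms unfolding simple_graphs_def by blast+
  then show "u \<noteq> v" "u \<in> {1..n}" "v \<in> {1..n}" by auto
qed

lemma simple_graphs_edgeE: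
  assumes "G \<in> simple_graphs n" "e \<in> G"
  obtains u v where "e = {u, v}" "u \<noteq> v" "u \<in> {1..n}" "v \<in> {1..n}"
proof -
  have "card e = 2" "e \<subseteq> {1..n}" using assms unfolding simple_graphs_def by blast+
  then show ?thesis using that by (auto simp: card_2_iff)
qed

lemma card_nbrs:
  assumes "G \<in> simple_graphs n"
  shows "card (nbrs G v) = vertex_degree G v"
  unfolding vertex_degree_def
proof (rule bij_betw_same_card[of "\<lambda>w. {v, w}"])
  show "bij_betw (\<lambda>w. {v, w}) (nbrs G v) {e \<in> G. v \<in> e}"
    unfolding bij_betw_def
  proof
    show "inj_on (\<lambda>w. {v, w}) (nbrs G v)"
      by (auto simp: inj_on_def doubleton_eq_iff)
    show "(\<lambda>w. {v, w}) ` nbrs G v = {e \<in> G. v \<in> e}"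
    proof (intro equalityI subsetI)
      fix e assume e: "e \<in> {e \<in> G. v \<in> e}"
      then obtain x y where "e = {x, y}" using simple_graphs_edgeE[OF assms] by blast
      with e obtain w where "e = {v, w}" by blast
      with e show "e \<in> (\<lambda>w. {v, w}) ` nbrs G v" by (simp add: nbrs_def)
    qed (auto simp: nbrs_def)
  qed
qed

lemma nbrs_subset: "G \<in> simple_graphs n \<Longrightarrow> nbrs G v \<subseteq> {1..n}"
  unfolding nbrs_def using simple_graphs_edgeD(3) by blast

lemma finite_nbrs: "G \<in> simple_graphs n \<Longrightarrow> finite (nbrs G v)"
  using finite_subset[OF nbrs_subset] by simp

lemma finite_arcs:
  assumes "G \<in> simple_graphs n"
  shows "finite (arcs G)"
proof (rule finite_subset)
  show "arcs G \<subseteq> {1..n} \<times> {1..n}"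
    unfolding arcs_def using simple_graphs_edgeD(2,3)[OF assms] by blast
qed simp

text \<open>Only an upper bound, because \<open>F\<close> is arbitrary: a singleton
  \<open>{v}\<close> gives the single arc \<open>(v, v)\<close>, and sets that are neither pairs nor
  singletons give none.\<close>

lemma card_arcs_le:
  assumes "finite F"
  shows "finite (arcs F) \<and> card (arcs F) \<le> 2 * card F"
  using assms
proof (induction F)
  case (insert e F)
  have "finite (arcs {e}) \<and> card (arcs {e}) \<le> 2"
  proof (cases "\<exists>u v. e = {u, v}")
    case True
    then obtain u v where "e = {u, v}" by blast
    then have eq: "arcs {e} = {(u, v), (v, u)}" by (auto simp: arcs_def doubleton_eq_iff)
    show ?thesis unfolding eq using card_insert_le_m1[of 2 "{(v, u)}" "(u, v)"] by simp
  next
    case False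
    then have eq: "arcs {e} = {}" unfolding arcs_def by blast
    show ?thesis unfolding eq by simp
  qed
  moreover have "arcs (insert e F) = arcs {e} \<union> arcs F" by (auto simp: arcs_def)
  ultimately show ?case
    using insert.IH insert.hyps card_Un_le[of "arcs {e}" "arcs F"]
    by (simp only: finite_Un card_insert_disjoint simp_thms mult_Suc_right) linarith
qed (simp add: arcs_def)

lemma card_arcs:
  assumes "G \<in> simple_graphs n"
  shows "card (arcs G) = 2 * card G"
proof -
  have "arcs G = (\<Union>e\<in>G. arcs {e})" by (auto simp: arcs_def)
  also have "card \<dots> = (\<Sum>e\<in>G. card (arcs {e}))"
    using card_arcs_le[of "{_}"] by (intro card_UN_disjoint simple_graphs_finite[OF assms]) (auto simp: arcs_def)
  also have "\<dots> = (\<Sum>e\<in>G. 2)"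
  proof (rule sum.cong)
    fix e assume "e \<in> G"
    then obtain u v where "e = {u, v}" "u \<noteq> v"
      using assms simple_graphs_edgeE by metis
    moreover from this have "arcs {e} = {(u, v), (v, u)}"
      by (auto simp: arcs_def doubleton_eq_iff)
    ultimately show "card (arcs {e}) = 2" by simp
  qed simp
  finally show ?thesis by simp
qed

lemma card_arcs_degrees:
  assumes "G \<in> graphs_with_degrees n d"
  shows "card (arcs G) = (\<Sum>i=1..n. d i)"
proof -
  have G: "G \<in> simple_graphs n" using assms by (simp add: graphs_with_degrees_def)
  have "arcs G = Sigma {1..n} (nbrs G)"
    unfolding arcs_def nbrs_def using simple_graphs_edgeD(2)[OF G] by blast
  also have "card \<dots> = (\<Sum>i=1..n. d i)"
    using assms finite_nbrs[OF G] by (auto simp: graphs_with_degrees_def card_nbrs)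
  finally show ?thesis .
qed

text \<open>Each of the four ends loses one edge and gains one. The hypotheses make the two new
  edges genuine pairs that differ from each other and from all edges of \<open>G\<close>.\<close>

lemma switch_graphs_with_degrees:
  assumes "G \<in> graphs_with_degrees n d" "{u, v} \<in> G" "{x, y} \<in> G"
    "{u, x} \<notin> G" "{v, y} \<notin> G" "u \<noteq> x" "u \<noteq> y" "v \<noteq> x" "v \<noteq> y"
  shows "switch G u v x y \<in> graphs_with_degrees n d"
proof -
  have G: "G \<in> simple_graphs n" using assms by (simp add: graphs_with_degrees_def)
  note ends = simple_graphs_edgeD[OF G assms(2)] simple_graphs_edgeD[OF G assms(3)]
  have fin: "finite G" using G by (rule simple_graphs_finite)
  let ?P = "{{u, v}, {x, y}}" and ?R = "{{u, x}, {v, y}}"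
  have "u \<notin> {x, y}" "u \<notin> {v, y}" using assms(6,7) ends by auto
  then have neq: "{u, v} \<noteq> {x, y}" "{u, x} \<noteq> {v, y}" by blast+
  have degree_sum: "vertex_degree E i = (\<Sum>e\<in>E. of_bool (i \<in> e))" if "finite E" for E and i :: nat
    using that by (simp add: vertex_degree_def Int_def)
  have "vertex_degree (switch G u v x y) i = vertex_degree G i" for i
  proof -
    let ?f = "\<lambda>e. of_bool (i \<in> e) :: nat"
    have R: "?R \<inter> (G - ?P) = {}" "?P \<subseteq> G" using assms(2-5) by simp_all
    have "vertex_degree (switch G u v x y) i = sum ?f (G - ?P) + sum ?f ?R"
      unfolding switch_def using fin R(1)
      by (subst degree_sum, simp, intro sum.union_disjoint) (auto simp only: finite_Diff finite.intros Int_commute)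
    also have "sum ?f ?R = sum ?f ?P"
      using neq assms(6-9) ends by (auto simp: of_bool_def)
    also have "sum ?f (G - ?P) + sum ?f ?P = vertex_degree G i"
      using fin R(2) by (simp only: degree_sum sum.subset_diff)
    finally show ?thesis .
  qed
  moreover have "switch G u v x y \<in> simple_graphs n"
    using G ends assms(6-9) unfolding simple_graphs_def switch_def by simp
  ultimately show ?thesis using assms(1) by (simp add: graphs_with_degrees_def)
qed

lemma switch_switch:
  assumes "{u, v} \<in> G" "{x, y} \<in> G" "{u, x} \<notin> G" "{v, y} \<notin> G"
  shows "switch (switch G u v x y) u x v y = G"
proof -
  have "G - P \<union> R - R \<union> P = G" if "P \<subseteq> G" "R \<inter> G = {}" for P R
    using that by blast
  from this[of "{{u, v}, {x, y}}" "{{u, x}, {v, y}}"] show ?thesis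
    unfolding switch_def using assms by simp
qed

locale bounded_degrees =
  fixes n D :: nat and d :: "nat \<Rightarrow> nat"
  assumes degree_bounds: "i \<in> {1..n} \<Longrightarrow> 1 \<le> d i \<and> d i \<le> D"
begin

abbreviation "GG \<equiv> graphs_with_degrees n d"

lemma simple: "G \<in> GG \<Longrightarrow> G \<in> simple_graphs n"
  by (simp add: graphs_with_degrees_def)

lemma card_nbrs_eq: "G \<in> GG \<Longrightarrow> v \<in> {1..n} \<Longrightarrow> card (nbrs G v) = d v"
  by (simp add: card_nbrs[OF simple]) (simp add: graphs_with_degrees_def)

lemma card_nbrs_le: "G \<in> GG \<Longrightarrow> card (nbrs G v) \<le> D"
proof (cases "v \<in> {1..n}")
  case False
  assume "G \<in> GG"
  then have "nbrs G v = {}"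
    using False simple_graphs_edgeD(2)[OF simple] unfolding nbrs_def by blast
  then show ?thesis by simp
qed (use degree_bounds card_nbrs_eq in auto)

lemma card_edges: "G \<in> GG \<Longrightarrow> 2 * card G = (\<Sum>i=1..n. d i)"
  using card_arcs_degrees card_arcs simple by metis

lemma sum_degrees_ge: "n \<le> (\<Sum>i=1..n. d i)"
  using sum_mono[of "{1..n}" "\<lambda>_. 1" d] degree_bounds by auto

lemma sum_degrees_le: "(\<Sum>i=1..n. d i) \<le> D * n"
  using sum_mono[of "{1..n}" d "\<lambda>_. D"] degree_bounds by (auto simp: mult.commute)

text \<open>The edge \<open>{u, v}\<close> is switched away against an arc \<open>(x, y)\<close>
  outside \<open>F\<close>. At most \<open>2 * (card F + 1)\<close> arcs belong to the protected
  edges; requiring \<open>x\<close> to avoid \<open>u\<close>, \<open>v\<close> and the neighbours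
  of \<open>u\<close> costs at most \<open>D * (D + 2)\<close> arcs, and likewise for
  \<open>y\<close> and \<open>v\<close>. To undo the switching, \<open>x\<close> must be chosen
  among the new neighbours of \<open>u\<close> and \<open>y\<close> among those of \<open>v\<close>,
  which leaves at most \<open>D\<^sup>2\<close> choices.\<close>

lemma card_graphs_containing_pair_step:
  assumes "finite F" "{u, v} \<notin> F" "u \<noteq> v"
  shows "((\<Sum>i=1..n. d i) - (2 * (card F + 1) + 2 * (D * (D + 2)))) *
           card {G \<in> GG. insert {u, v} F \<subseteq> G} \<le> D\<^sup>2 * card {G \<in> GG. F \<subseteq> G}"
proof (rule double_counting)
  let ?bx = "\<lambda>G. {u, v} \<union> nbrs G u" and ?by = "\<lambda>G. {u, v} \<union> nbrs G v"
  let ?f = "\<lambda>G. {(x, y) \<in> arcs G. {x, y} \<notin> insert {u, v} F \<and> x \<notin> ?bx G \<and> y \<notin> ?by G}"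
  let ?h = "\<lambda>(G, (x, y)). (switch G u v x y, (x, y))"
  let ?A = "{G \<in> GG. insert {u, v} F \<subseteq> G}"
  show "finite ?A" "finite {G \<in> GG. F \<subseteq> G}"
    using finite_graphs_with_degrees by auto
  show "finite (?f G) \<and> (\<Sum>i=1..n. d i) - (2 * (card F + 1) + 2 * (D * (D + 2))) \<le> card (?f G)"
    if "G \<in> ?A" for G
  proof
    from that have G: "G \<in> GG" by simp
    note fin = finite_arcs[OF simple[OF G]]
    show finf: "finite (?f G)" by (rule finite_subset[OF _ fin]) auto
    define bad where "bad X = Sigma X (nbrs G)" for X
    have bad: "finite (bad X) \<and> card (bad X) \<le> D * (D + 2)" if "X \<subseteq> {u, v} \<union> nbrs G w" for X w
    proof -
      have finX: "finite X" using that finite_nbrs[OF simple[OF G]] by (auto intro: finite_subset)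
      have "card X \<le> card ({u, v} \<union> nbrs G w)"
        using that finite_nbrs[OF simple[OF G]] by (intro card_mono) auto
      also have "\<dots> \<le> card {u, v} + card (nbrs G w)" by (rule card_Un_le)
      also have "\<dots> \<le> D + 2" using card_nbrs_le[OF G] assms(3) by simp
      finally have X: "card X \<le> D + 2" .
      have "card (bad X) = (\<Sum>x\<in>X. card (nbrs G x))"
        unfolding bad_def using finX finite_nbrs[OF simple[OF G]] by simp
      also have "\<dots> \<le> (\<Sum>x\<in>X. D)" using card_nbrs_le[OF G] by (intro sum_mono) auto
      also have "\<dots> \<le> D * (D + 2)" using mult_le_mono2[OF X, of D] by (simp add: mult.commute)
      finally show ?thesis using finX finite_nbrs[OF simple[OF G]] by (auto simp: bad_def)
    qed
    let ?E = "arcs (insert {u, v} F)"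
    \<comment> \<open>The set \<open>bad X\<close> holds the arcs that start in \<open>X\<close>;
      \<open>prod.swap\<close> turns them into the arcs that end there.\<close>
    have "arcs G \<subseteq> ?f G \<union> ?E \<union> bad (?bx G) \<union> prod.swap ` bad (?by G)"
      by (auto simp: arcs_def bad_def nbrs_def insert_commute image_iff)
    then have "card (arcs G) \<le> card (?f G \<union> ?E \<union> bad (?bx G) \<union> prod.swap ` bad (?by G))"
      using finf bad[of "?bx G" u] bad[of "?by G" v] card_arcs_le[of "insert {u, v} F"] assms(1)
      by (intro card_mono) auto
    also have "\<dots> \<le> card (?f G) + card ?E + card (bad (?bx G)) + card (prod.swap ` bad (?by G))"
      by (meson card_Un_le add_le_mono order_refl order_trans)
    also have "\<dots> \<le> card (?f G) + 2 * (card F + 1) + D * (D + 2) + D * (D + 2)"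
    proof (intro add_mono order_refl)
      show "card ?E \<le> 2 * (card F + 1)"
        using card_arcs_le[of "insert {u, v} F"] assms by simp
      show "card (bad (?bx G)) \<le> D * (D + 2)" using bad by blast
      have "card (prod.swap ` bad (?by G)) \<le> card (bad (?by G))"
        using bad[of "?by G" v] by (intro card_image_le) auto
      also have "\<dots> \<le> D * (D + 2)" using bad by blast
      finally show "card (prod.swap ` bad (?by G)) \<le> D * (D + 2)" .
    qed
    finally show "(\<Sum>i=1..n. d i) - (2 * (card F + 1) + 2 * (D * (D + 2))) \<le> card (?f G)"
      using card_arcs_degrees[OF G] by simp
  qed
  have ok: "switch G u v x y \<in> GG \<and> switch (switch G u v x y) u x v y = G"
    if "G \<in> GG" "insert {u, v} F \<subseteq> G" "(x, y) \<in> arcs G" "x \<notin> ?bx G" "y \<notin> ?by G" for G x y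
  proof -
    from that have "{u, v} \<in> G" "{x, y} \<in> G" "{u, x} \<notin> G" "{v, y} \<notin> G" "u \<noteq> x" "u \<noteq> y" "v \<noteq> x" "v \<noteq> y"
      by (simp_all add: arcs_def nbrs_def)
    then show ?thesis using that(1) switch_graphs_with_degrees switch_switch by metis
  qed
  show "inj_on ?h (Sigma ?A ?f)"
  proof (rule inj_on_inverseI)
    fix p assume p: "p \<in> Sigma ?A ?f"
    obtain G x y where [simp]: "p = (G, (x, y))" by (metis surj_pair)
    from p have "G \<in> GG" "insert {u, v} F \<subseteq> G" "(x, y) \<in> arcs G" "x \<notin> ?bx G" "y \<notin> ?by G"
      by simp_all
    then show "(\<lambda>(G, (x, y)). (switch G u x v y, (x, y))) (?h p) = p"
      using ok[of G x y] by simp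
  qed
  show "?h ` Sigma ?A ?f \<subseteq> Sigma {G \<in> GG. F \<subseteq> G} (\<lambda>G. nbrs G u \<times> nbrs G v)"
  proof (rule image_subsetI)
    fix p assume p: "p \<in> Sigma ?A ?f"
    obtain G x y where [simp]: "p = (G, (x, y))" by (metis surj_pair)
    from p have *: "G \<in> GG" "insert {u, v} F \<subseteq> G" "(x, y) \<in> arcs G" "{x, y} \<notin> insert {u, v} F"
      "x \<notin> ?bx G" "y \<notin> ?by G"
      by simp_all
    then have "switch G u v x y \<in> GG" using ok by blast
    moreover have "F \<subseteq> switch G u v x y" using *(2,4) assms(2) unfolding switch_def by auto
    moreover have "x \<in> nbrs (switch G u v x y) u" "y \<in> nbrs (switch G u v x y) v"
      by (simp_all add: switch_def nbrs_def)
    ultimately show "?h p \<in> Sigma {G \<in> GG. F \<subseteq> G} (\<lambda>G. nbrs G u \<times> nbrs G v)"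
      by simp
  qed
  show "finite (nbrs G u \<times> nbrs G v) \<and> card (nbrs G u \<times> nbrs G v) \<le> D\<^sup>2"
    if "G \<in> {G \<in> GG. F \<subseteq> G}" for G
    using that finite_nbrs[OF simple] card_nbrs_le
    by (auto simp: card_cartesian_product power2_eq_square intro!: mult_mono)
qed

end

section \<open>The probability that given edges are present\<close>

text \<open>The term of index \<open>k\<close> in the exponential series at \<open>k\<close> is at
  most the whole sum.\<close>

lemma power_le_exp_fact: "real k ^ k \<le> exp (real k) * fact k"
proof -
  have "(\<Sum>i\<in>{k}. real k ^ i /\<^sub>R fact i) \<le> (\<Sum>i. real k ^ i /\<^sub>R fact i)"
    by (intro sum_le_suminf summable_exp_generic) auto
  then have "real k ^ k / fact k \<le> exp (real k)"
    by (simp add: exp_def divide_inverse mult.commute)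
  then show ?thesis by (simp add: divide_le_eq)
qed

text \<open>The product is \<open>fact k\<close> times a binomial coefficient; the latter is at
  least \<open>(m / k) ^ k\<close>, the former at least \<open>(k / exp 1) ^ k\<close>. The whole
  range \<open>k \<le> m\<close> matters, since the prescribed edges may make up an entire
  graph.\<close>

lemma falling_factorial_ge:
  assumes "k \<le> m"
  shows "(real m / exp 1) ^ k \<le> (\<Prod>j<k. real (m - j))"
proof (cases "k = 0")
  case False
  have "(real m / exp 1) ^ k = real m ^ k / exp (real k)"
    by (simp add: power_divide flip: exp_of_nat_mult)
  also have "\<dots> \<le> (real m / real k) ^ k * fact k"
    using mult_right_mono[OF power_le_exp_fact[of k], of "real m ^ k"] False
    by (simp add: power_divide field_simps)
  also have "\<dots> \<le> real (m choose k) * fact k"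
    using assms by (intro mult_right_mono binomial_ge_n_over_k_pow_k) auto
  also have "\<dots> = (\<Prod>j<k. real (m - j))"
    using assms by (simp add: binomial_gbinomial gbinomial_prod_rev of_nat_diff atLeast0LessThan)
  finally show ?thesis .
qed simp

context bounded_degrees
begin

text \<open>Let \<open>m\<close> be the number of edges and \<open>B = 2 * (D + 1)\<^sup>2\<close>.
  The switching bound has the factor \<open>2 * (m - card F) - B\<close>, which is at least
  \<open>m - card F\<close> as long as \<open>B \<le> m - card F\<close>. Otherwise
  \<open>m - card F < B\<close>, and it suffices that adding a condition cannot increase the number
  of graphs. In this form the bound survives until \<open>F\<close> is nearly the whole
  graph.\<close>

lemma card_graphs_containing_step:
  assumes "finite F" "e \<notin> F"
  shows "((\<Sum>i=1..n. d i) div 2 - card F) * card {G \<in> GG. insert e F \<subseteq> G}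
           \<le> 2 * (D + 1)\<^sup>2 * card {G \<in> GG. F \<subseteq> G}"
proof (cases "{G \<in> GG. insert e F \<subseteq> G} = {}")
  case False
  define m where "m = (\<Sum>i=1..n. d i) div 2"
  define B where "B = 2 * (D + 1)\<^sup>2"
  let ?N = "card {G \<in> GG. F \<subseteq> G}" and ?N' = "card {G \<in> GG. insert e F \<subseteq> G}"
  from False obtain G where G: "G \<in> GG" "e \<in> G" by blast
  then obtain u v where e: "e = {u, v}" "u \<noteq> v"
    using simple simple_graphs_edgeE by metis
  have m2: "(\<Sum>i=1..n. d i) = 2 * m" using card_edges[OF G(1)] unfolding m_def by presburger
  have *: "(2 * m - 2 * card F - B) * ?N' \<le> D\<^sup>2 * ?N"
  proof -
    have eq: "2 * (card F + 1) + 2 * (D * (D + 2)) = 2 * card F + B"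
      by (simp add: B_def power2_eq_square algebra_simps)
    from card_graphs_containing_pair_step[OF assms(1) assms(2)[unfolded e(1)] e(2), unfolded eq m2]
    show ?thesis by (simp only: e(1) diff_diff_left)
  qed
  have "(m - card F) * ?N' \<le> B * ?N"
  proof (cases "B \<le> m - card F")
    case True
    then have "(m - card F) * ?N' \<le> (2 * m - 2 * card F - B) * ?N'"
      by (intro mult_right_mono) auto
    also note *
    also have "D\<^sup>2 * ?N \<le> B * ?N"
      by (intro mult_right_mono) (auto simp: B_def power2_eq_square)
    finally show ?thesis .
  next
    case False
    have "?N' \<le> ?N"
      by (intro card_mono finite_subset[OF _ finite_graphs_with_degrees[of n d]]) auto
    with False show ?thesis by (intro mult_mono) auto
  qed
  then show ?thesis by (simp add: m_def B_def)
qed (simp only: card.empty mult_0_right)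

lemma card_graphs_containing_prod:
  assumes "finite F"
  shows "card {G \<in> GG. F \<subseteq> G} * (\<Prod>j<card F. (\<Sum>i=1..n. d i) div 2 - j)
           \<le> (2 * (D + 1)\<^sup>2) ^ card F * card GG"
  using assms
proof (induction F)
  case (insert e F)
  define m where "m = (\<Sum>i=1..n. d i) div 2"
  define B where "B = 2 * (D + 1)\<^sup>2"
  have "card {G \<in> GG. insert e F \<subseteq> G} * (\<Prod>j<card (insert e F). m - j) =
      (m - card F) * card {G \<in> GG. insert e F \<subseteq> G} * (\<Prod>j<card F. m - j)"
    using insert.hyps by simp
  also have "\<dots> \<le> B * card {G \<in> GG. F \<subseteq> G} * (\<Prod>j<card F. m - j)"
    using card_graphs_containing_step[OF insert.hyps] by (intro mult_right_mono) (auto simp: m_def B_def)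
  also have "\<dots> = B * (card {G \<in> GG. F \<subseteq> G} * (\<Prod>j<card F. m - j))"
    by simp
  also have "\<dots> \<le> B * (B ^ card F * card GG)"
    using insert.IH unfolding m_def B_def by (rule mult_left_mono) simp
  also have "\<dots> = B ^ card (insert e F) * card GG"
    using insert.hyps by simp
  finally show ?case by (simp add: m_def B_def)
qed simp

text \<open>In the constant, \<open>2 * (D + 1)\<^sup>2\<close> is the cost of one edge,
  \<open>exp 1\<close> comes from the falling factorial, and a further factor 2 from
  \<open>n \<le> 2 * m\<close>, as every degree is at least 1.\<close>

lemma card_graphs_containing:
  assumes "finite F" "n > 0"
  shows "real (card {G \<in> GG. F \<subseteq> G}) \<le> (4 * exp 1 * (real (D + 1))\<^sup>2 / real n) ^ card F * real (card GG)"
proof (cases "{G \<in> GG. F \<subseteq> G} = {}")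
  case False
  define m where "m = (\<Sum>i=1..n. d i) div 2"
  define B where "B = 2 * (D + 1)\<^sup>2"
  let ?N = "card {G \<in> GG. F \<subseteq> G}" and ?k = "card F"
  from False obtain G where G: "G \<in> GG" "F \<subseteq> G" by blast
  have m2: "2 * m = (\<Sum>i=1..n. d i)" "m = card G"
    using card_edges[OF G(1)] unfolding m_def by presburger+
  then have n: "n \<le> 2 * m" using sum_degrees_ge by simp
  have "?k \<le> m"
    unfolding m2 using G simple simple_graphs_finite by (intro card_mono) blast+
  then have "real ?N * (real m / exp 1) ^ ?k \<le> real ?N * (\<Prod>j<?k. real (m - j))"
    by (intro mult_left_mono falling_factorial_ge) auto
  also have "\<dots> = real (?N * (\<Prod>j<?k. m - j))" by simp
  also have "\<dots> \<le> real (B ^ ?k * card GG)"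
    using card_graphs_containing_prod[OF assms(1)] unfolding m_def B_def of_nat_le_iff .
  finally have "real ?N \<le> (real B / (real m / exp 1)) ^ ?k * card GG"
    using n assms(2) by (simp add: power_divide field_simps)
  also have "\<dots> \<le> (4 * exp 1 * (real (D + 1))\<^sup>2 / real n) ^ ?k * card GG"
  proof (intro mult_right_mono power_mono)
    have "real B * exp 1 * real n \<le> real B * exp 1 * real (2 * m)"
      using n by (intro mult_left_mono) auto
    then show "real B / (real m / exp 1) \<le> 4 * exp 1 * (real (D + 1))\<^sup>2 / real n"
      using n assms(2) by (simp add: B_def field_simps)
  qed auto
  finally show ?thesis .
qed (simp only: card.empty of_nat_0, simp)

end

section \<open>Creating small symmetric components\<close>

text \<open>Exchanging two twins is an automorphism. Deleting each vertex from the neighbourhood of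
  the other covers adjacent and non-adjacent twins at once.\<close>

lemma transpose_symmetric_graph:
  assumes "G \<in> simple_graphs n" "a \<in> {1..n}" "b \<in> {1..n}" "a \<noteq> b"
    and nbrs: "nbrs G a - {b} = nbrs G b - {a}"
  shows "symmetric_graph n G"
proof -
  let ?p = "Transposition.transpose a b"
  have swap: "{a, w} \<in> G \<longleftrightarrow> {b, w} \<in> G" if "w \<noteq> a" "w \<noteq> b" for w
    using nbrs that unfolding nbrs_def by blast
  have "?p ` e \<in> G" if "e \<in> G" for e
  proof -
    obtain x y where e: "e = {x, y}" "x \<noteq> y"
      using assms(1) \<open>e \<in> G\<close> simple_graphs_edgeE by metis
    have "?p ` e = {?p x, ?p y}" by (simp add: e)
    also have "\<dots> \<in> G"
    proof -
      \<comment> \<open>With adjacency as a symmetric relation, the claim becomes a case split on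
        which of \<open>x\<close> and \<open>y\<close> equals \<open>a\<close> or
        \<open>b\<close>.\<close>
      define R where "R s t \<longleftrightarrow> {s, t} \<in> G" for s t
      have R: "R s t \<longleftrightarrow> R t s" for s t by (simp add: R_def insert_commute)
      have "R a w \<longleftrightarrow> R b w" if "w \<noteq> a" "w \<noteq> b" for w using swap that by (simp add: R_def)
      moreover have "R x y" using that e by (simp add: R_def)
      ultimately have "R (?p x) (?p y)"
        using e(2) R Transposition.transpose_apply_first[of a b]
          Transposition.transpose_apply_second[of a b] Transposition.transpose_apply_other[of _ a b]
        by metis
      then show ?thesis by (simp add: R_def)
    qed
    finally show ?thesis .
  qed
  then have sub: "(\<lambda>e. ?p ` e) ` G \<subseteq> G" by blast
  moreover have "e \<in> (\<lambda>e. ?p ` e) ` G" if "e \<in> G" for e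
  proof -
    have "e = ?p ` (?p ` e)" by (simp add: image_image)
    then show ?thesis using sub that by blast
  qed
  ultimately have "(\<lambda>e. ?p ` e) ` G = G" by blast
  then have "?p \<in> automorphisms n G"
    using assms(2,3) by (simp add: automorphisms_def permutes_swap_id)
  moreover have "?p \<noteq> id" using assms(4) by (metis id_apply Transposition.transpose_apply_first)
  ultimately show ?thesis by (auto simp: symmetric_graph_def asymmetric_graph_def)
qed

context bounded_degrees
begin

section \<open>Edges joining two leaves\<close>

definition leaves :: "nat set" where
  "leaves = {i \<in> {1..n}. d i = 1}"

definition leaf_arcs :: "nat set set \<Rightarrow> (nat \<times> nat) set" where
  "leaf_arcs G = arcs G \<inter> leaves \<times> leaves"

lemma leaf_arcs_symmetric:
  assumes "G \<in> GG" "leaf_arcs G \<noteq> {}"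
  shows "symmetric_graph n G"
proof -
  obtain u w where uw: "u \<in> leaves" "w \<in> leaves" "{u, w} \<in> G"
    using assms(2) by (auto simp: leaf_arcs_def arcs_def)
  have single: "nbrs G u = {w}" if "u \<in> leaves" "{u, w} \<in> G" for u w
  proof -
    have "card (nbrs G u) = 1" using that card_nbrs_eq[OF assms(1)] by (simp add: leaves_def)
    moreover have "w \<in> nbrs G u" using that by (simp add: nbrs_def)
    ultimately show ?thesis by (auto simp: card_1_singleton_iff)
  qed
  have "nbrs G u - {w} = nbrs G w - {u}"
    using uw single[of u w] single[of w u] by (simp add: insert_commute)
  moreover have "u \<noteq> w" using simple_graphs_edgeD[OF simple[OF assms(1)] uw(3)] by simp
  ultimately show ?thesis
    using uw simple[OF assms(1)] by (intro transpose_symmetric_graph[of G n u w]) (auto simp: leaves_def)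
qed

text \<open>Two leaves \<open>u\<close>, \<open>w\<close> and their neighbours are switched so that
  \<open>u\<close> and \<open>w\<close> become adjacent and so do their former neighbours. At most
  \<open>D + D\<^sup>2\<close> choices of \<open>w\<close> are excluded for a given
  \<open>u\<close>. The result has a single edge between leaves, hence two leaf arcs; to undo the
  switching one chooses one of them and one of at most \<open>D * n\<close> arcs for the former
  neighbours.\<close>

lemma leaf_switching:
  "card leaves * (card leaves - (D + D\<^sup>2)) * card {G \<in> GG. leaf_arcs G = {}}
     \<le> 2 * (D * n) * card {G \<in> GG. leaf_arcs G \<noteq> {} \<and> card (leaf_arcs G) \<le> 2}"
proof (rule double_counting)
  let ?A = "{G \<in> GG. leaf_arcs G = {}}"
  let ?B = "{G \<in> GG. leaf_arcs G \<noteq> {} \<and> card (leaf_arcs G) \<le> 2}"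
  \<comment> \<open>For a leaf this picks its only neighbour. In \<open>bad\<close>, the first part
    excludes \<open>w = u\<close> and \<open>q G w = q G u\<close>; the second excludes that
    \<open>q G u\<close> and \<open>q G w\<close> are already adjacent.\<close>
  define q where "q G u = (SOME x. x \<in> nbrs G u)" for G u
  define bad where "bad G u = nbrs G (q G u) \<union> (\<Union>z\<in>nbrs G (q G u). nbrs G z)" for G u
  let ?f = "\<lambda>G. Sigma leaves (\<lambda>u. leaves - bad G u)"
  let ?h = "\<lambda>(G, (u, w)). (switch G u (q G u) w (q G w), ((u, w), (q G u, q G w)))"
  let ?g = "\<lambda>G. leaf_arcs G \<times> arcs G"
  show "finite ?A" "finite ?B"
    using finite_graphs_with_degrees by auto
  have finl: "finite leaves" by (simp add: leaves_def)
  have q: "{u, q G u} \<in> G" if "G \<in> GG" "u \<in> leaves" for G u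
  proof -
    have "card (nbrs G u) = 1" using that card_nbrs_eq[OF that(1)] by (simp add: leaves_def)
    then have "\<exists>x. x \<in> nbrs G u" by (auto simp: card_1_singleton_iff)
    then have "q G u \<in> nbrs G u" unfolding q_def by (rule someI_ex)
    then show ?thesis by (simp add: nbrs_def)
  qed
  show "finite (?f G) \<and> card leaves * (card leaves - (D + D\<^sup>2)) \<le> card (?f G)" if "G \<in> ?A" for G
  proof
    have G: "G \<in> GG" using that by simp
    note fin = finite_nbrs[OF simple[OF G]]
    show "finite (?f G)" using finl by auto
    have bad: "finite (bad G u) \<and> card (bad G u) \<le> D + D\<^sup>2" for u
    proof
      show "finite (bad G u)" using fin by (simp add: bad_def)
      have "card (\<Union>z\<in>nbrs G (q G u). nbrs G z) \<le> (\<Sum>z\<in>nbrs G (q G u). card (nbrs G z))"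
        using fin by (rule card_UN_le)
      also have "\<dots> \<le> (\<Sum>z\<in>nbrs G (q G u). D)" by (intro sum_mono card_nbrs_le[OF G])
      also have "\<dots> \<le> D\<^sup>2"
        using card_nbrs_le[OF G, of "q G u"] by (simp add: power2_eq_square)
      finally show "card (bad G u) \<le> D + D\<^sup>2"
        unfolding bad_def using card_nbrs_le[OF G, of "q G u"]
        by (intro order_trans[OF card_Un_le] add_mono)
    qed
    have "card leaves * (card leaves - (D + D\<^sup>2)) = (\<Sum>u\<in>leaves. card leaves - (D + D\<^sup>2))"
      by simp
    also have "\<dots> \<le> (\<Sum>u\<in>leaves. card (leaves - bad G u))"
    proof (rule sum_mono)
      fix u
      show "card leaves - (D + D\<^sup>2) \<le> card (leaves - bad G u)"
        using bad[of u] diff_card_le_card_Diff[of "bad G u" leaves] by linarith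
    qed
    also have "\<dots> = card (?f G)" using finl by simp
    finally show "card leaves * (card leaves - (D + D\<^sup>2)) \<le> card (?f G)" .
  qed
  have ok: "u \<noteq> w" "q G u \<notin> leaves" "switch G u (q G u) w (q G w) \<in> GG"
    "switch (switch G u (q G u) w (q G w)) u w (q G u) (q G w) = G"
    if "G \<in> GG" "leaf_arcs G = {}" "u \<in> leaves" "w \<in> leaves" "w \<notin> bad G u" for G u w
  proof -
    have nl: "{s, t} \<notin> G" if "s \<in> leaves" "t \<in> leaves" for s t
      using \<open>leaf_arcs G = {}\<close> that unfolding leaf_arcs_def arcs_def by blast
    note qu = q[OF that(1,3)] and qw = q[OF that(1,4)]
    have "u \<in> nbrs G (q G u)" "w \<in> nbrs G (q G w)"
      using qu qw by (simp_all add: nbrs_def insert_commute)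
    then show 1: "u \<noteq> w" using that(5) by (auto simp: bad_def)
    have neq: "q G u \<noteq> q G w" using \<open>w \<in> nbrs G (q G w)\<close> that(5) by (auto simp: bad_def)
    have nadj: "{q G u, q G w} \<notin> G"
      using \<open>w \<in> nbrs G (q G w)\<close> that(5) by (auto simp: bad_def nbrs_def)
    show 2: "q G u \<notin> leaves" using nl[OF that(3)] qu by blast
    have 3: "q G w \<notin> leaves" using nl[OF that(4)] qw by blast
    have "u \<noteq> q G w" "q G u \<noteq> w" using 2 3 that(3,4) by auto
    then show "switch G u (q G u) w (q G w) \<in> GG"
      using that 1 neq nadj qu qw nl by (intro switch_graphs_with_degrees) auto
    show "switch (switch G u (q G u) w (q G w)) u w (q G u) (q G w) = G"
      using that nadj qu qw nl by (intro switch_switch) auto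
  qed
  show "inj_on ?h (Sigma ?A ?f)"
  proof (rule inj_on_inverseI)
    fix p assume p: "p \<in> Sigma ?A ?f"
    obtain G u w where [simp]: "p = (G, (u, w))" by (metis surj_pair)
    from p show "(\<lambda>(G, ((u, w), (x, y))). (switch G u w x y, (u, w))) (?h p) = p"
      using ok(4)[of G u w] by simp
  qed
  show "?h ` Sigma ?A ?f \<subseteq> Sigma ?B ?g"
  proof (rule image_subsetI)
    fix p assume p: "p \<in> Sigma ?A ?f"
    obtain G u w where [simp]: "p = (G, (u, w))" by (metis surj_pair)
    from p have *: "G \<in> GG" "leaf_arcs G = {}" "u \<in> leaves" "w \<in> leaves" "w \<notin> bad G u" by simp_all
    let ?G = "switch G u (q G u) w (q G w)"
    have "{u, w} \<in> ?G" "{q G u, q G w} \<in> ?G" by (simp_all add: switch_def)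
    then have "(u, w) \<in> leaf_arcs ?G" "(q G u, q G w) \<in> arcs ?G"
      using * by (simp_all add: leaf_arcs_def arcs_def)
    \<comment> \<open>The other new edge contains \<open>q G u\<close>, which is not a leaf because
      \<open>G\<close> has no edge between leaves.\<close>
    moreover have "leaf_arcs ?G \<subseteq> {(u, w), (w, u)}"
    proof (rule subrelI)
      fix s t assume "(s, t) \<in> leaf_arcs ?G"
      then have st: "s \<in> leaves" "t \<in> leaves" "{s, t} \<in> ?G" by (simp_all add: leaf_arcs_def arcs_def)
      then have "{s, t} \<notin> G" using *(2) unfolding leaf_arcs_def arcs_def by blast
      then have "{s, t} = {u, w} \<or> {s, t} = {q G u, q G w}"
        using st(3) unfolding switch_def by blast
      then have "{s, t} = {u, w}" using ok(2)[OF *] st by (auto simp: doubleton_eq_iff)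
      then show "(s, t) \<in> {(u, w), (w, u)}" by (auto simp: doubleton_eq_iff)
    qed
    then have "card (leaf_arcs ?G) \<le> card {(u, w), (w, u)}" by (intro card_mono) auto
    then have "card (leaf_arcs ?G) \<le> 2" using ok(1)[OF *] by simp
    ultimately show "?h p \<in> Sigma ?B ?g" using ok(3)[OF *] by auto
  qed
  show "finite (?g G) \<and> card (?g G) \<le> 2 * (D * n)" if "G \<in> ?B" for G
  proof -
    have "card (arcs G) \<le> D * n" "finite (arcs G)"
      using that card_arcs_degrees[of G n d] sum_degrees_le finite_arcs simple by auto
    then show ?thesis
      using that by (auto simp: leaf_arcs_def card_cartesian_product intro!: mult_mono)
  qed
qed

section \<open>Triangle components on vertices of degree 2\<close>

definition triangles :: "nat set set \<Rightarrow> nat set set" where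
  "triangles G = {t. t \<subseteq> {i \<in> {1..n}. d i = 2} \<and> card t = 3 \<and> (\<forall>x\<in>t. \<forall>y\<in>t. x \<noteq> y \<longrightarrow> {x, y} \<in> G)}"

text \<open>The other two vertices already exhaust the degree 2 of \<open>x\<close>. Hence these
  triangles are components, and a vertex lies in at most one of them.\<close>

lemma nbrs_triangle:
  assumes "G \<in> GG" "t \<in> triangles G" "x \<in> t"
  shows "nbrs G x = t - {x}"
proof (rule sym, rule card_subset_eq)
  show "finite (nbrs G x)" using simple[OF assms(1)] by (rule finite_nbrs)
  show "t - {x} \<subseteq> nbrs G x"
    using assms(2,3) by (auto simp: triangles_def nbrs_def)
  have "card (t - {x}) = 2" "x \<in> {1..n}" "d x = 2"
    using assms(2,3) by (auto simp: triangles_def)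
  then show "card (t - {x}) = card (nbrs G x)" using card_nbrs_eq[OF assms(1)] by simp
qed

lemma triangles_symmetric:
  assumes "G \<in> GG" "triangles G \<noteq> {}"
  shows "symmetric_graph n G"
proof -
  obtain t where t: "t \<in> triangles G" using assms(2) by blast
  then have "card t = 3" by (simp add: triangles_def)
  then obtain a b c where abc: "t = {a, b, c}" "a \<noteq> b" by (auto simp: card_3_iff)
  then have "nbrs G a - {b} = nbrs G b - {a}"
    using nbrs_triangle[OF assms(1) t] by auto
  then show ?thesis
    using abc t simple[OF assms(1)]
    by (intro transpose_symmetric_graph[of G n a b]) (auto simp: triangles_def)
qed

text \<open>Every triangle of \<open>G'\<close> must contain an edge that is not in
  \<open>G\<close>, and different triangles are disjoint, so these edges are different.\<close>

lemma card_triangles_le: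
  assumes "G \<in> GG" "triangles G = {}" "G' \<in> GG"
  shows "finite (triangles G') \<and> card (triangles G') \<le> card (G' - G)"
proof
  show "finite (triangles G')"
    by (rule finite_subset[of _ "Pow {1..n}"]) (auto simp: triangles_def)
  \<comment> \<open>Nonemptiness is recorded so that two triangles with the same chosen edge share a
    vertex.\<close>
  have "\<exists>e. e \<in> G' - G \<and> e \<subseteq> t \<and> e \<noteq> {}" if t: "t \<in> triangles G'" for t
  proof (rule ccontr)
    assume *: "\<not> ?thesis"
    have "t \<in> triangles G" unfolding triangles_def
    proof (intro CollectI conjI ballI impI)
      fix x y assume xy: "x \<in> t" "y \<in> t" "x \<noteq> y"
      then have "{x, y} \<in> G'" using t by (simp add: triangles_def)
      then show "{x, y} \<in> G" using * xy by blast
    qed (use t in \<open>simp_all add: triangles_def\<close>)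
    then show False using assms(2) by blast
  qed
  then obtain e where e: "\<And>t. t \<in> triangles G' \<Longrightarrow> e t \<in> G' - G \<and> e t \<subseteq> t \<and> e t \<noteq> {}"
    by metis
  have "inj_on e (triangles G')"
  proof (rule inj_onI)
    fix s t assume st: "s \<in> triangles G'" "t \<in> triangles G'" "e s = e t"
    then obtain x where x: "x \<in> s" "x \<in> t" using e[of s] e[of t] by fastforce
    then have "s - {x} = t - {x}"
      using nbrs_triangle[OF assms(3) st(1) x(1)] nbrs_triangle[OF assms(3) st(2) x(2)] by simp
    with x show "s = t" by blast
  qed
  then show "card (triangles G') \<le> card (G' - G)"
    using e simple_graphs_finite[OF simple[OF assms(3)]] by (intro card_inj_on_le[of e]) auto
qed

text \<open>Going cyclically through \<open>a\<close>, \<open>b\<close>, \<open>c\<close>, each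
  switching creates one side of the triangle and one edge between former neighbours, and every
  vertex gives up each of its two listed edges once. The switchings are undone in the opposite
  order. Each adds at most two edges, which explains the 6.\<close>

lemma triangle_switch:
  fixes a a1 a2 b b1 b2 c c1 c2 :: nat
  defines "G1 \<equiv> \<lambda>G. switch G a a2 b b1"
  defines "G2 \<equiv> \<lambda>G. switch (G1 G) b b2 c c1"
  defines "G3 \<equiv> \<lambda>G. switch (G2 G) c c2 a a1"
  assumes G: "G \<in> GG"
    and edges: "{a, a1} \<in> G" "{a, a2} \<in> G" "{b, b1} \<in> G" "{b, b2} \<in> G" "{c, c1} \<in> G" "{c, c2} \<in> G"
    and non_edges: "{a, b} \<notin> G" "{b, c} \<notin> G" "{c, a} \<notin> G" "{a2, b1} \<notin> G" "{b2, c1} \<notin> G" "{c2, a1} \<notin> G"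
    and dist: "distinct [a, a1, a2, b, b1, b2, c, c1, c2]"
  shows "G3 G \<in> GG"
    and "switch (switch (switch (G3 G) c a c2 a1) b c b2 c1) a b a2 b1 = G"
    and "{{a, b}, {b, c}, {c, a}, {a2, b1}, {b2, c1}, {c2, a1}} \<subseteq> G3 G"
    and "card (G3 G - G) \<le> 6"
proof -
  \<comment> \<open>The reversed list supplies every inequality with its sides exchanged.\<close>
  have "distinct (rev [a, a1, a2, b, b1, b2, c, c1, c2])" using dist by (simp only: distinct_rev)
  note neqs = dist[simplified] this[simplified]
  have 1: "G1 G \<in> GG"
    unfolding G1_def using G edges non_edges neqs by (intro switch_graphs_with_degrees) auto
  have m1: "{b, b2} \<in> G1 G" "{c, c1} \<in> G1 G" "{b, c} \<notin> G1 G" "{b2, c1} \<notin> G1 G"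
    unfolding G1_def switch_def using edges non_edges neqs by (simp_all add: doubleton_eq_iff)
  have 2: "G2 G \<in> GG"
    unfolding G2_def using 1 m1 neqs by (intro switch_graphs_with_degrees) auto
  have m2: "{c, c2} \<in> G2 G" "{a, a1} \<in> G2 G" "{c, a} \<notin> G2 G" "{c2, a1} \<notin> G2 G"
    unfolding G2_def G1_def switch_def using edges non_edges neqs by (simp_all add: doubleton_eq_iff)
  show "G3 G \<in> GG"
    unfolding G3_def using 2 m2 neqs by (intro switch_graphs_with_degrees) auto
  have "switch (G3 G) c a c2 a1 = G2 G" unfolding G3_def using m2 by (rule switch_switch)
  moreover have "switch (G2 G) b c b2 c1 = G1 G" unfolding G2_def using m1 by (rule switch_switch)
  moreover have "switch (G1 G) a b a2 b1 = G"
    unfolding G1_def using edges non_edges by (intro switch_switch) auto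
  ultimately show "switch (switch (switch (G3 G) c a c2 a1) b c b2 c1) a b a2 b1 = G" by simp
  show "{{a, b}, {b, c}, {c, a}, {a2, b1}, {b2, c1}, {c2, a1}} \<subseteq> G3 G"
    unfolding G3_def G2_def G1_def switch_def using neqs by (simp add: doubleton_eq_iff)
  let ?new = "[{a, b}, {b, c}, {c, a}, {a2, b1}, {b2, c1}, {c2, a1}]"
  have "(G - P \<union> {e1, e4} - Q \<union> {e2, e5}) - R \<union> {e3, e6} - G \<subseteq> set [e1, e2, e3, e4, e5, e6]"
    for P Q R and e1 e2 e3 e4 e5 e6 :: "nat set"
    unfolding list.set by blast
  then have "G3 G - G \<subseteq> set ?new"
    unfolding G3_def G2_def G1_def switch_def .
  then have "card (G3 G - G) \<le> card (set ?new)" by (intro card_mono) auto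
  also have "\<dots> \<le> length ?new" by (rule card_length)
  finally show "card (G3 G - G) \<le> 6" by simp
qed

text \<open>The second vertex must be far from the first, and the third far from both, which
  excludes at most \<open>(D + 1) ^ 3\<close> and \<open>2 * (D + 1) ^ 3\<close> vertices. To undo
  the switchings one chooses a triple from the cube of one of at most 6 triangles, giving
  \<open>162 = 6 * 27\<close>, and three arcs between the former neighbours.\<close>

lemma triangle_switching:
  fixes n2 :: nat
  assumes n2: "n2 = card {i \<in> {1..n}. d i = 2}"
  shows "n2 * ((n2 - (D + 1) ^ 3) * (n2 - 2 * (D + 1) ^ 3)) * card {G \<in> GG. triangles G = {}}
     \<le> 162 * (D * n) ^ 3 * card {G \<in> GG. triangles G \<noteq> {} \<and> card (triangles G) \<le> 6}"
proof -
  let ?A = "{G \<in> GG. triangles G = {}}"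
  let ?B = "{G \<in> GG. triangles G \<noteq> {} \<and> card (triangles G) \<le> 6}"
  define T where "T = {i \<in> {1..n}. d i = 2}"
  define K where "K = (D + 1) ^ 3"
  define cl where "cl G x = insert x (nbrs G x)" for G x
  \<comment> \<open>This is the ball of radius 3. For a vertex of degree at most \<open>D\<close>
    the closed neighbourhood has at most \<open>D + 1\<close> elements; vertices outside each
    other's balls have disjoint closed neighbourhoods with no edge between them.\<close>
  define near where "near G a = (\<Union>x\<in>cl G a. \<Union>y\<in>cl G x. cl G y)" for G a
  have "\<exists>x y. x \<noteq> y \<and> {a, x} \<in> G \<and> {a, y} \<in> G" if "G \<in> GG" "a \<in> T" for G a
  proof -
    have "card (nbrs G a) = 2" using that card_nbrs_eq[OF that(1)] by (simp add: T_def)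
    then obtain x y where "nbrs G a = {x, y}" "x \<noteq> y" by (auto simp: card_2_iff)
    then show ?thesis unfolding nbrs_def by blast
  qed
  then obtain p q where pq: "\<And>G a. G \<in> GG \<Longrightarrow> a \<in> T \<Longrightarrow> p G a \<noteq> q G a \<and> {a, p G a} \<in> G \<and> {a, q G a} \<in> G"
    by metis
  show ?thesis
  proof (rule double_counting)
    let ?f = "\<lambda>G. Sigma T (\<lambda>a. Sigma (T - near G a) (\<lambda>b. T - (near G a \<union> near G b)))"
    let ?s = "\<lambda>G a b c. switch (switch (switch G a (q G a) b (p G b)) b (q G b) c (p G c)) c (q G c) a (p G a)"
    let ?h = "\<lambda>(G, (a, b, c)). (?s G a b c, ((a, b, c), ((q G a, p G b), (q G b, p G c), (q G c, p G a))))"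
    let ?g = "\<lambda>G. (\<Union>t\<in>triangles G. t \<times> t \<times> t) \<times> (arcs G \<times> arcs G \<times> arcs G)"
    show "finite ?A" "finite ?B"
      using finite_graphs_with_degrees by auto
    have finT: "finite T" by (simp add: T_def)
    show "finite (?f G) \<and> n2 * ((n2 - (D + 1) ^ 3) * (n2 - 2 * (D + 1) ^ 3)) \<le> card (?f G)" if "G \<in> ?A" for G
    proof
      have G: "G \<in> GG" using that by simp
      show "finite (?f G)" using finT by auto
      have cl: "finite (cl G x)" "card (cl G x) \<le> D + 1" for x
        using finite_nbrs[OF simple[OF G], of x] card_nbrs_le[OF G, of x]
        by (auto simp: cl_def card_insert_if)
      have un: "card (\<Union>x\<in>cl G a. S x) \<le> (D + 1) * k" if "\<And>x. card (S x) \<le> k" for a k and S :: "nat \<Rightarrow> nat set"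
      proof -
        have "card (\<Union>x\<in>cl G a. S x) \<le> (\<Sum>x\<in>cl G a. card (S x))" using cl(1) by (rule card_UN_le)
        also have "\<dots> \<le> (\<Sum>x\<in>cl G a. k)" using that by (rule sum_mono)
        also have "\<dots> = card (cl G a) * k" by simp
        also have "\<dots> \<le> (D + 1) * k" using cl(2) by (rule mult_right_mono) simp
        finally show ?thesis .
      qed
      have near: "finite (near G a)" "card (near G a) \<le> K" for a
      proof -
        show "finite (near G a)" using cl by (simp add: near_def)
        have "card (near G a) \<le> (D + 1) * ((D + 1) * (D + 1))"
          unfolding near_def by (intro un cl)
        then show "card (near G a) \<le> K" by (simp only: K_def power3_eq_cube mult.assoc)
      qed
      have c: "n2 - 2 * K \<le> card (T - (near G a \<union> near G b))" for a b
        using diff_card_le_card_Diff[of "near G a \<union> near G b" T] near[of a] near[of b]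
          card_Un_le[of "near G a" "near G b"] unfolding n2 T_def by auto
      have "(n2 - K) * (n2 - 2 * K) \<le> card (T - near G a) * (n2 - 2 * K)" for a
        using diff_card_le_card_Diff[of "near G a" T] near[of a]
        unfolding n2 T_def by (intro mult_right_mono) auto
      also have "card (T - near G a) * (n2 - 2 * K) = (\<Sum>b\<in>T - near G a. n2 - 2 * K)" for a by simp
      also have "(\<Sum>b\<in>T - near G a. n2 - 2 * K) \<le> (\<Sum>b\<in>T - near G a. card (T - (near G a \<union> near G b)))" for a
        by (intro sum_mono c)
      finally have b: "(n2 - K) * (n2 - 2 * K) \<le> (\<Sum>b\<in>T - near G a. card (T - (near G a \<union> near G b)))" for a .
      have "n2 * ((n2 - K) * (n2 - 2 * K)) = (\<Sum>a\<in>T. (n2 - K) * (n2 - 2 * K))"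
        by (simp add: n2 T_def)
      also have "\<dots> \<le> (\<Sum>a\<in>T. \<Sum>b\<in>T - near G a. card (T - (near G a \<union> near G b)))"
        by (intro sum_mono b)
      also have "\<dots> = card (?f G)" using finT by simp
      finally show "n2 * ((n2 - (D + 1) ^ 3) * (n2 - 2 * (D + 1) ^ 3)) \<le> card (?f G)"
        by (simp only: K_def)
    qed
    have far: "x \<noteq> y \<and> {x, y} \<notin> G" if "b \<notin> near G a" "x \<in> cl G a" "y \<in> cl G b" for G a b x y
    proof -
      have "b \<in> cl G y" using that(3) by (auto simp: cl_def nbrs_def insert_commute)
      then have "y \<notin> cl G x" using that(1,2) unfolding near_def by blast
      then show ?thesis by (auto simp: cl_def nbrs_def)
    qed
    have ok: "?s G a b c \<in> GG"
      "switch (switch (switch (?s G a b c) c a (q G c) (p G a)) b c (q G b) (p G c)) a b (q G a) (p G b) = G"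
      "{{a, b}, {b, c}, {c, a}, {q G a, p G b}, {q G b, p G c}, {q G c, p G a}} \<subseteq> ?s G a b c"
      "card (?s G a b c - G) \<le> 6" "distinct [a, b, c]"
      if "G \<in> GG" "a \<in> T" "b \<in> T" "c \<in> T" "b \<notin> near G a" "c \<notin> near G a" "c \<notin> near G b" for G a b c
    proof -
      have e: "{a, p G a} \<in> G" "{a, q G a} \<in> G" "{b, p G b} \<in> G" "{b, q G b} \<in> G" "{c, p G c} \<in> G" "{c, q G c} \<in> G"
        and pq': "p G a \<noteq> q G a" "p G b \<noteq> q G b" "p G c \<noteq> q G c"
        using pq that(1-4) by blast+
      have loop: "a \<noteq> p G a" "a \<noteq> q G a" "b \<noteq> p G b" "b \<noteq> q G b" "c \<noteq> p G c" "c \<noteq> q G c"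
        using e simple_graphs_edgeD(1)[OF simple[OF that(1)]] by blast+
      have cls: "x \<in> cl G x" for x by (simp add: cl_def)
      have in_cl: "p G a \<in> cl G a" "q G a \<in> cl G a" "p G b \<in> cl G b" "q G b \<in> cl G b" "p G c \<in> cl G c" "q G c \<in> cl G c"
        using e by (simp_all add: cl_def nbrs_def)
      have ne: "{a, b} \<notin> G" "{b, c} \<notin> G" "{c, a} \<notin> G" "{q G a, p G b} \<notin> G" "{q G b, p G c} \<notin> G" "{q G c, p G a} \<notin> G"
        using far[OF that(5)] far[OF that(6)] far[OF that(7)] in_cl cls by (metis insert_commute)+
      have dist: "distinct [a, p G a, q G a, b, p G b, q G b, c, p G c, q G c]"
        using far[OF that(5), THEN conjunct1] far[OF that(6), THEN conjunct1] far[OF that(7), THEN conjunct1]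
          in_cl cls loop pq' unfolding distinct.simps list.set insert_iff empty_iff by metis
      note ts = triangle_switch[OF that(1) e ne dist]
      show "?s G a b c \<in> GG" by (rule ts)
      show "switch (switch (switch (?s G a b c) c a (q G c) (p G a)) b c (q G b) (p G c)) a b (q G a) (p G b) = G"
        by (rule ts)
      show "{{a, b}, {b, c}, {c, a}, {q G a, p G b}, {q G b, p G c}, {q G c, p G a}} \<subseteq> ?s G a b c"
        by (rule ts)
      show "card (?s G a b c - G) \<le> 6" by (rule ts)
      show "distinct [a, b, c]" using dist by auto
    qed
    show "inj_on ?h (Sigma ?A ?f)"
    proof (rule inj_on_inverseI)
      fix r assume r: "r \<in> Sigma ?A ?f"
      obtain G a b c where [simp]: "r = (G, (a, b, c))" by (metis surj_pair)
      from r have *: "G \<in> GG" "a \<in> T" "b \<in> T" "c \<in> T" "b \<notin> near G a" "c \<notin> near G a" "c \<notin> near G b"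
        by simp_all
      show "(\<lambda>(G, ((a, b, c), ((a2, b1), (b2, c1), (c2, a1)))).
          (switch (switch (switch G c a c2 a1) b c b2 c1) a b a2 b1, (a, b, c))) (?h r) = r"
        using ok(2)[OF *] by simp
    qed
    show "?h ` Sigma ?A ?f \<subseteq> Sigma ?B ?g"
    proof (rule image_subsetI)
      fix r assume r: "r \<in> Sigma ?A ?f"
      obtain G a b c where r_eq [simp]: "r = (G, (a, b, c))" by (metis surj_pair)
      from r have *: "G \<in> GG" "a \<in> T" "b \<in> T" "c \<in> T" "b \<notin> near G a" "c \<notin> near G a" "c \<notin> near G b"
        and none: "triangles G = {}"
        by simp_all
      let ?G = "?s G a b c"
      have "card (triangles ?G) \<le> 6"
        using card_triangles_le[OF *(1) none ok(1)[OF *]] ok(4)[OF *] by linarith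
      moreover have t: "{a, b, c} \<in> triangles ?G"
        using ok(3,5)[OF *] *(2-4) by (auto simp: triangles_def T_def insert_commute)
      moreover have "(q G a, p G b) \<in> arcs ?G" "(q G b, p G c) \<in> arcs ?G" "(q G c, p G a) \<in> arcs ?G"
        using ok(3)[OF *] by (simp_all add: arcs_def)
      moreover have "(a, b, c) \<in> (\<Union>t\<in>triangles ?G. t \<times> t \<times> t)" using t by blast
      ultimately have "?G \<in> ?B" "((a, b, c), ((q G a, p G b), (q G b, p G c), (q G c, p G a))) \<in> ?g ?G"
        using ok(1)[OF *] by blast+
      then show "?h r \<in> Sigma ?B ?g" by (simp only: r_eq prod.case mem_Sigma_iff)
    qed
    show "finite (?g G) \<and> card (?g G) \<le> 162 * (D * n) ^ 3" if "G \<in> ?B" for G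
    proof
      have a: "card (arcs G) \<le> D * n" "finite (arcs G)"
        using that card_arcs_degrees[of G n d] sum_degrees_le finite_arcs simple by auto
      have t: "finite (triangles G)" "card (triangles G) \<le> 6"
        using that by (auto intro: finite_subset[of _ "Pow {1..n}"] simp: triangles_def)
      have t3: "finite t \<and> card (t \<times> t \<times> t) = 27" if "t \<in> triangles G" for t
        using that by (auto simp: triangles_def card_cartesian_product intro: card_ge_0_finite)
      then show "finite (?g G)" using a t by auto
      have "card (\<Union>t\<in>triangles G. t \<times> t \<times> t) \<le> (\<Sum>t\<in>triangles G. card (t \<times> t \<times> t))"
        using t(1) by (rule card_UN_le)
      also have "\<dots> = (\<Sum>t\<in>triangles G. 27)"
        by (rule sum.cong[OF refl]) (rule t3[THEN conjunct2])
      finally have "card (\<Union>t\<in>triangles G. t \<times> t \<times> t) \<le> 162" using t(2) by simp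
      moreover have "card (arcs G) ^ 3 \<le> (D * n) ^ 3" using a(1) by (rule power_mono) simp
      ultimately have "card (\<Union>t\<in>triangles G. t \<times> t \<times> t) * card (arcs G) ^ 3 \<le> 162 * (D * n) ^ 3"
        by (rule mult_mono) simp_all
      then show "card (?g G) \<le> 162 * (D * n) ^ 3"
        by (simp only: card_cartesian_product power3_eq_cube mult.assoc)
    qed
  qed
qed

end

section \<open>Permutations of prime order\<close>

text \<open>A coincidence of two iterates would give \<open>x\<close> a period smaller than
  \<open>p\<close>. That period is coprime to \<open>p\<close>, so by Bezout \<open>x\<close> would
  also have period 1.\<close>

lemma funpow_prime_period:
  assumes "prime p" "f ^^ p = id" "f x \<noteq> x"
  shows "inj_on (\<lambda>k. (f ^^ k) x) {..<p}"
proof -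
  have "inj f"
  proof (rule inj_on_inverseI)
    fix y
    have "(f ^^ (p - 1)) (f y) = (f ^^ (Suc (p - 1))) y" by (simp only: funpow_swap1 funpow.simps o_apply)
    also have "Suc (p - 1) = p" using prime_gt_0_nat[OF assms(1)] by simp
    finally show "(f ^^ (p - 1)) (f y) = y" using assms(2) by simp
  qed
  then have inj: "inj (f ^^ k)" for k by (rule inj_fn)
  have no_collision: "(f ^^ i) x \<noteq> (f ^^ j) x" if "i < j" "j < p" for i j
  proof
    assume "(f ^^ i) x = (f ^^ j) x"
    also have "(f ^^ j) x = (f ^^ i) ((f ^^ (j - i)) x)"
      using that by (simp flip: funpow_add comp_apply[of "f ^^ i"])
    finally have m: "(f ^^ (j - i)) x = x" using injD[OF inj] by metis
    have mult: "(f ^^ (k * l)) x = x" if "(f ^^ k) x = x" for k l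
      using that by (induction l) (simp_all add: funpow_add)
    have "\<not> p dvd (j - i)" using that by (intro nat_dvd_not_less) auto
    then have "coprime (j - i) p" using assms(1) by (simp add: coprime_commute prime_imp_coprime)
    then have "gcd (j - i) p = 1" by simp
    moreover have "j - i \<noteq> 0" using that by simp
    ultimately obtain k l where "(j - i) * k = p * l + 1"
      using bezout_nat[of "j - i" p] by fastforce
    then have "(f ^^ ((j - i) * k)) x = f ((f ^^ (p * l)) x)" by simp
    then show False using mult[OF m] mult[of p l] assms(2,3) by simp
  qed
  show ?thesis
  proof (rule inj_onI)
    fix i j assume "i \<in> {..<p}" "j \<in> {..<p}" "(f ^^ i) x = (f ^^ j) x"
    then show "i = j" using no_collision[of i j] no_collision[of j i] by (cases i j rule: linorder_cases) auto
  qed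
qed

text \<open>Only forward iterates are taken; under \<open>f ^^ p = id\<close> with
  \<open>p > 0\<close> they form the whole cycle of \<open>x\<close>.\<close>

definition iterates :: "('a \<Rightarrow> 'a) \<Rightarrow> 'a \<Rightarrow> 'a set" where
  "iterates f x = range (\<lambda>k. (f ^^ k) x)"

lemma self_in_iterates: "x \<in> iterates f x"
  unfolding iterates_def by (rule range_eqI[of _ _ 0]) simp

lemma iterates_closed: "(\<And>x. x \<in> A \<Longrightarrow> f x \<in> A) \<Longrightarrow> x \<in> A \<Longrightarrow> iterates f x \<subseteq> A"
proof -
  assume *: "\<And>x. x \<in> A \<Longrightarrow> f x \<in> A" "x \<in> A"
  have "(f ^^ k) x \<in> A" for k by (induction k) (use * in auto)
  then show ?thesis by (auto simp: iterates_def)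
qed

lemma iterates_eq_image:
  assumes "f ^^ p = id" "p > 0"
  shows "iterates f x = (\<lambda>k. (f ^^ k) x) ` {..<p}"
proof -
  have "(f ^^ k) x = (f ^^ (k mod p)) x" for k
    using funpow_mod_eq[where f = f and n = p and m = k and x = x] assms(1) by simp
  moreover have "k mod p \<in> {..<p}" for k using assms(2) by simp
  ultimately show ?thesis unfolding iterates_def by blast
qed

lemma iterates_eq:
  assumes "f ^^ p = id" "p > 0" "y \<in> iterates f x"
  shows "iterates f y = iterates f x"
proof -
  have sub: "iterates f y \<subseteq> iterates f x" if "y \<in> iterates f x" for x y
  proof (rule iterates_closed[OF _ that])
    fix z assume "z \<in> iterates f x"
    then obtain k where "z = (f ^^ k) x" by (auto simp: iterates_def)
    then have "f z = (f ^^ Suc k) x" by simp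
    then show "f z \<in> iterates f x" unfolding iterates_def by blast
  qed
  obtain k where k: "k < p" "y = (f ^^ k) x"
    using assms by (auto simp: iterates_eq_image)
  then have "(f ^^ (p - k)) y = (f ^^ ((p - k) + k)) x" by (simp only: funpow_add o_apply)
  then have "x = (f ^^ (p - k)) y" using k assms(1) by simp
  then have "x \<in> iterates f y" unfolding iterates_def by blast
  then show ?thesis using sub assms(3) by blast
qed

lemma card_iterates:
  assumes "prime p" "f ^^ p = id" "f x \<noteq> x"
  shows "card (iterates f x) = p"
  using card_image[OF funpow_prime_period[OF assms]] iterates_eq_image[OF assms(2)] prime_gt_0_nat[OF assms(1)]
  by simp

section \<open>Exponential bounds for weighted sums over sets\<close>

lemma sum_Pow_prod_le_exp:
  fixes g :: "'a \<Rightarrow> real"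
  assumes "finite A" "\<And>x. x \<in> A \<Longrightarrow> g x \<ge> 0"
  shows "(\<Sum>X\<in>Pow A. \<Prod>x\<in>X. g x) \<le> exp (\<Sum>x\<in>A. g x)"
proof -
  have "(\<Sum>X\<in>Pow A. \<Prod>x\<in>X. g x) = (\<Prod>x\<in>A. g x + 1)"
    using prod_add[OF assms(1), of g "\<lambda>_. 1"] by simp
  also have "\<dots> \<le> (\<Prod>x\<in>A. exp (g x))"
    using assms(2) by (intro prod_mono) (auto simp: add.commute intro: add_nonneg_nonneg)
  also have "\<dots> = exp (\<Sum>x\<in>A. g x)" using assms(1) by (simp add: exp_sum)
  finally show ?thesis .
qed

text \<open>A bound for elementary symmetric polynomials. It turns a sum over all supports of a
  given size into a power that involves only the total weight.\<close>

lemma sum_subsets_card_prod_le: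
  fixes w :: "'a \<Rightarrow> real"
  assumes "finite V" "\<And>v. v \<in> V \<Longrightarrow> w v \<ge> 0" "sum w V > 0" "a > 0"
  shows "(\<Sum>S | S \<subseteq> V \<and> card S = a. \<Prod>s\<in>S. w s) \<le> (exp 1 * sum w V / real a) ^ a"
proof -
  \<comment> \<open>the scaling \<open>x\<close> of the weights minimises \<open>exp (x * sum w V) / x ^ a\<close>\<close>
  define x where "x = real a / sum w V"
  have x: "x > 0" using assms by (simp add: x_def)
  have "x ^ a * (\<Sum>S | S \<subseteq> V \<and> card S = a. \<Prod>s\<in>S. w s) = (\<Sum>S | S \<subseteq> V \<and> card S = a. \<Prod>s\<in>S. x * w s)"
    by (auto simp: sum_distrib_left prod.distrib intro!: sum.cong)
  also have "\<dots> \<le> (\<Sum>S\<in>Pow V. \<Prod>s\<in>S. x * w s)"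
    using assms x by (intro sum_mono2 prod_nonneg) auto
  also have "\<dots> \<le> exp (\<Sum>v\<in>V. x * w v)"
    using assms x by (intro sum_Pow_prod_le_exp) auto
  also have "(\<Sum>v\<in>V. x * w v) = real a * 1"
    using assms(3) unfolding x_def sum_distrib_left[symmetric] by simp
  finally have "(\<Sum>S | S \<subseteq> V \<and> card S = a. \<Prod>s\<in>S. w s) \<le> exp 1 ^ a / x ^ a"
    using x by (simp only: exp_of_nat_mult) (simp add: field_simps)
  then show ?thesis by (simp add: x_def power_divide power_mult_distrib)
qed

text \<open>An invariant set is a union of cycles, so the sum runs over sets of cycles, with the
  product of \<open>u\<close> over a cycle as its weight. A cycle has length 1 or \<open>p\<close>,
  and \<open>u\<close> is constant on it.\<close>

lemma sum_invariant_sets_le_exp: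
  fixes f :: "'a \<Rightarrow> 'a" and u :: "'a \<Rightarrow> real"
  assumes "prime p" "f ^^ p = id" "finite E" "\<And>e. e \<in> E \<Longrightarrow> f e \<in> E"
    and "\<And>e. e \<in> E \<Longrightarrow> u e \<ge> 0" "\<And>e. e \<in> E \<Longrightarrow> u (f e) = u e"
  shows "(\<Sum>F | F \<subseteq> E \<and> f ` F \<subseteq> F. \<Prod>e\<in>F. u e) \<le> exp (\<Sum>e\<in>E. if f e = e then u e else u e ^ p)"
proof -
  let ?orb = "iterates f" and ?I = "{F. F \<subseteq> E \<and> f ` F \<subseteq> F}"
  define g where "g Q = (\<Prod>e\<in>Q. u e)" for Q
  have p: "p > 0" using assms(1) by (rule prime_gt_0_nat)
  note orb_eq = iterates_eq[OF assms(2) p]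
  have orbE: "?orb e \<subseteq> E" if "e \<in> E" for e using assms(4) that by (rule iterates_closed)
  have fin: "finite (?orb e)" for e by (simp add: iterates_eq_image[OF assms(2) p])
  have Union: "\<Union> (?orb ` F) = F" if "F \<in> ?I" for F
    using that iterates_closed[of F f] self_in_iterates[of _ f] by blast
  have prod: "(\<Prod>e\<in>F. u e) = (\<Prod>Q\<in>?orb ` F. g Q)" if F: "F \<in> ?I" for F
  proof -
    have "(\<Prod>e\<in>\<Union> (?orb ` F). u e) = (\<Prod>Q\<in>?orb ` F. \<Prod>e\<in>Q. u e)"
    proof (rule prod.Union_disjoint[unfolded o_def])
      show "\<forall>A\<in>?orb ` F. finite A" using fin by blast
      show "\<forall>A\<in>?orb ` F. \<forall>B\<in>?orb ` F. A \<noteq> B \<longrightarrow> A \<inter> B = {}"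
        using orb_eq by blast
    qed
    then show ?thesis unfolding Union[OF F] g_def .
  qed
  have g_nonneg: "g Q \<ge> 0" if "Q \<in> ?orb ` E" for Q
    unfolding g_def using that orbE assms(5) by (intro prod_nonneg) auto
  have "(\<Sum>F\<in>?I. \<Prod>e\<in>F. u e) = (\<Sum>F\<in>?I. \<Prod>Q\<in>?orb ` F. g Q)"
    by (intro sum.cong refl prod)
  \<comment> \<open>Reindexing is possible because taking the union recovers \<open>F\<close> from
    its set of cycles.\<close>
  also have "\<dots> = (\<Sum>X\<in>(\<lambda>F. ?orb ` F) ` ?I. \<Prod>Q\<in>X. g Q)"
    using Union by (subst sum.reindex) (auto intro!: inj_on_inverseI[of _ Union])
  also have "\<dots> \<le> (\<Sum>X\<in>Pow (?orb ` E). \<Prod>Q\<in>X. g Q)"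
    using assms(3) g_nonneg by (intro sum_mono2 prod_nonneg) auto
  also have "\<dots> \<le> exp (\<Sum>Q\<in>?orb ` E. g Q)"
    using assms(3) g_nonneg by (intro sum_Pow_prod_le_exp) auto
  \<comment> \<open>Summing over elements instead counts a cycle once for each of its elements,
    which is harmless for nonnegative weights.\<close>
  also have "(\<Sum>Q\<in>?orb ` E. g Q) \<le> (\<Sum>e\<in>E. g (?orb e))"
    using sum_image_le[OF assms(3), of g ?orb] g_nonneg by (simp add: o_def)
  also have "(\<Sum>e\<in>E. g (?orb e)) = (\<Sum>e\<in>E. if f e = e then u e else u e ^ p)"
  proof (rule sum.cong[OF refl])
    fix e assume e: "e \<in> E"
    have closed: "f x \<in> {x \<in> E. u x = u e}" if "x \<in> {x \<in> E. u x = u e}" for x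
      using that assms(4,6) by auto
    have "?orb e \<subseteq> {x \<in> E. u x = u e}" by (rule iterates_closed[OF closed]) (use e in auto)
    then have "g (?orb e) = (\<Prod>x\<in>?orb e. u e)" unfolding g_def by (intro prod.cong refl) blast
    then have g: "g (?orb e) = u e ^ card (?orb e)" by simp
    have "card (?orb e) = 1" if "f e = e"
    proof -
      have "?orb e \<subseteq> {e}" by (rule iterates_closed) (use that in auto)
      then have "?orb e = {e}" using self_in_iterates[of e f] by blast
      then show ?thesis by simp
    qed
    then show "g (?orb e) = (if f e = e then u e else u e ^ p)"
      using g card_iterates[OF assms(1,2), of e] by simp
  qed
  finally show ?thesis by simp
qed

text \<open>
  If \<open>R\<close> contains one element of every cycle, then \<open>f\<close> is determined by \<open>R\<close> and its values off \<open>R\<close>: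
  these values form chains, and \<open>f\<close> maps \<open>x \<in> R\<close> to the start of the chain that ends in \<open>x\<close>.
\<close>
lemma card_prime_order_permutations:
  assumes "prime p" "finite S" "S \<noteq> {}"
  defines "P \<equiv> {f. f ^^ p = id \<and> {x. f x \<noteq> x} = S}"
  shows "finite P" and "real (card P) \<le> (2 * real (card S) / real (card S) powr (1 / real p)) ^ card S"
proof -
  define a where "a = card S"
  define r where "r = a div p"
  have a: "a > 0" using assms by (simp add: a_def card_gt_0_iff)
  have p: "p > 0" using assms(1) by (rule prime_gt_0_nat)
  let ?T = "{R. R \<subseteq> S \<and> card R = r}"
  let ?C = "Sigma ?T (\<lambda>R. (S - R) \<rightarrow>\<^sub>E S)"
  have per: "(f ^^ p) x = x" if "f \<in> P" for f x using that by (simp add: P_def)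
  have support: "f x = x \<longleftrightarrow> x \<notin> S" if "f \<in> P" for f x
    using that unfolding P_def by blast
  \<comment> \<open>If \<open>f x\<close> were fixed, all later iterates would equal
    \<open>f x\<close>, while \<open>f ^^ p = id\<close> makes one of them equal to
    \<open>x\<close>.\<close>
  have inS: "f x \<in> S" if "f \<in> P" "x \<in> S" for f x
  proof (rule ccontr)
    assume "f x \<notin> S"
    then have fx: "f (f x) = f x" using support[OF that(1)] by simp
    then have "(f ^^ k) (f x) = f x" for k by (induction k) auto
    then have "f x = (f ^^ (p - 1)) (f x)" by simp
    also have "\<dots> = (f ^^ Suc (p - 1)) x" by (simp only: funpow_swap1 funpow.simps o_apply)
    also have "\<dots> = x" using p per[OF that(1)] by (simp del: funpow.simps)
    finally show False using support[OF that(1)] that(2) by simp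
  qed
  have transversal: "\<exists>R. R \<in> ?T \<and> a = p * r \<and> (\<forall>x\<in>R. iterates f x \<inter> R = {x})" if f: "f \<in> P" for f
  proof -
    have fp: "f ^^ p = id" using f by (simp add: P_def)
    define rep where "rep Q = (SOME x. x \<in> Q)" for Q :: "'a set"
    define R where "R = rep ` iterates f ` S"
    have rep: "rep (iterates f x) \<in> iterates f x" for x
      unfolding rep_def by (rule someI[of _ x]) (rule self_in_iterates)
    have orb: "iterates f (rep (iterates f x)) = iterates f x" for x
      by (rule iterates_eq[OF fp p rep])
    have orbS: "iterates f x \<subseteq> S" if "x \<in> S" for x
      using inS[OF f] that by (rule iterates_closed)
    have RS: "R \<subseteq> S" using rep orbS by (auto simp: R_def)
    have "p * card (iterates f ` S) = card (\<Union> (iterates f ` S))"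
    proof (rule card_partition)
      show "finite (iterates f ` S)" using assms(2) by simp
      show "finite (\<Union> (iterates f ` S))" using assms(2) orbS by (auto intro: finite_subset)
      show "card c = p" if "c \<in> iterates f ` S" for c
        using that card_iterates[OF assms(1) fp] support[OF f] by auto
      show "c1 \<inter> c2 = {}" if "c1 \<in> iterates f ` S" "c2 \<in> iterates f ` S" "c1 \<noteq> c2" for c1 c2
        using that iterates_eq[OF fp p] by blast
    qed
    also have "\<Union> (iterates f ` S) = S" using orbS self_in_iterates[of _ f] by blast
    finally have pr: "p * card (iterates f ` S) = a" by (simp add: a_def)
    have "inj_on rep (iterates f ` S)"
      using orb by (intro inj_on_inverseI[of _ "iterates f"]) auto
    then have "card R = card (iterates f ` S)" unfolding R_def by (rule card_image)
    then have "card R = r" "a = p * r" using pr p by (auto simp: r_def)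
    moreover have "iterates f x \<inter> R = {x}" if x: "x \<in> R" for x
    proof -
      obtain s where s: "x = rep (iterates f s)" using x by (auto simp: R_def)
      have "y = x" if "y \<in> R" "y \<in> iterates f x" for y
      proof -
        obtain z where z: "y = rep (iterates f z)" using \<open>y \<in> R\<close> by (auto simp: R_def)
        have "iterates f z = iterates f y" using z orb by simp
        also have "\<dots> = iterates f x" using iterates_eq[OF fp p that(2)] .
        also have "\<dots> = iterates f s" using s orb by simp
        finally show ?thesis using s z by simp
      qed
      then show ?thesis using x self_in_iterates[of x f] by blast
    qed
    ultimately show ?thesis using RS by blast
  qed
  then obtain R where R: "\<And>f. f \<in> P \<Longrightarrow> R f \<in> ?T \<and> a = p * r \<and> (\<forall>x\<in>R f. iterates f x \<inter> R f = {x})"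
    by metis
  have inj: "inj_on (\<lambda>f. (R f, restrict f (S - R f))) P"
  proof (rule inj_onI)
    fix f g assume fg: "f \<in> P" "g \<in> P" and "(R f, restrict f (S - R f)) = (R g, restrict g (S - R g))"
    then have Rfg: "R f = R g" and "restrict f (S - R f) = restrict g (S - R f)" by auto
    have agree: "f x = g x" if "x \<in> S" "x \<notin> R f" for x
      using fun_cong[OF \<open>restrict f _ = _\<close>, of x] that by simp
    show "f = g"
    proof
      fix x
      consider "x \<notin> S" | "x \<in> S" "x \<notin> R f" | "x \<in> S" "x \<in> R f" by satx
      then show "f x = g x"
      proof cases
        case 1 then show ?thesis using support fg by metis
      next
        case 2 then show ?thesis by (rule agree)
      next
        case 3
        have fx: "f x \<noteq> x" using 3 support[OF fg(1)] by simp
        have fp: "f ^^ p = id" using fg by (simp add: P_def)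
        \<comment> \<open>From \<open>f x\<close> on, \<open>g\<close> follows the cycle of
          \<open>f\<close> back to \<open>x\<close>, since \<open>x\<close> is the only point of
          \<open>R f\<close> on it. One more application of \<open>g\<close> completes
          \<open>p\<close> steps from \<open>f x\<close>, so \<open>g x = f x\<close>.\<close>
        have "(g ^^ j) (f x) = (f ^^ Suc j) x" if "j < p" for j
          using that
        proof (induction j)
          case (Suc j)
          let ?z = "(f ^^ Suc j) x"
          have "?z \<noteq> (f ^^ 0) x"
            using funpow_prime_period[OF assms(1) fp fx] Suc.prems p
            by (metis Suc_lessD inj_on_contraD lessThan_iff nat.distinct(1))
          then have "?z \<noteq> x" by simp
          moreover have "?z \<in> iterates f x" unfolding iterates_def by blast
          ultimately have "?z \<notin> R f" using R[OF fg(1)] 3 by blast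
          moreover have "?z \<in> S"
            using iterates_closed[of S f x] inS[OF fg(1)] 3 \<open>?z \<in> iterates f x\<close> by blast
          ultimately have "g ?z = f ?z" using agree by simp
          then show ?case using Suc by simp
        qed simp
        from this[of "p - 1"] have "(g ^^ (p - 1)) (f x) = x"
          using p per[OF fg(1), of x] by (simp del: funpow.simps)
        then have "g x = (g ^^ Suc (p - 1)) (f x)" by simp
        then show ?thesis using p per[OF fg(2), of "f x"] by (simp del: funpow.simps)
      qed
    qed
  qed
  have finT: "finite ?T" using assms(2) by (intro finite_subset[of ?T "Pow S"]) auto
  have finC: "finite ?C" using finT assms(2) by (intro finite_SigmaI finite_PiE) auto
  have im: "(\<lambda>f. (R f, restrict f (S - R f))) ` P \<subseteq> ?C"
  proof (rule image_subsetI)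
    fix f assume f: "f \<in> P"
    show "(R f, restrict f (S - R f)) \<in> ?C"
      using R[OF f] inS[OF f] by (simp add: restrict_PiE_iff)
  qed
  show "finite P" using inj im finC by (rule inj_on_finite)
  show "real (card P) \<le> (2 * real (card S) / real (card S) powr (1 / real p)) ^ card S"
  proof (cases "P = {}")
    case False
    then have ar: "a = p * r" using R by blast
    have "card P \<le> card ?C" using inj im finC by (rule card_inj_on_le)
    also have "\<dots> = (\<Sum>R\<in>?T. a ^ (a - r))"
      using finT assms(2)
    proof (subst card_SigmaI)
      show "(\<Sum>R\<in>?T. card ((S - R) \<rightarrow>\<^sub>E S)) = (\<Sum>R\<in>?T. a ^ (a - r))"
      proof (rule sum.cong[OF refl])
        fix R assume R: "R \<in> ?T"
        then have "finite R" using assms(2) finite_subset by auto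
        with R show "card ((S - R) \<rightarrow>\<^sub>E S) = a ^ (a - r)"
          using assms(2) by (simp add: card_PiE a_def card_Diff_subset)
      qed
    qed (auto intro!: finite_PiE)
    also have "\<dots> = card ?T * a ^ (a - r)" by simp
    also have "\<dots> \<le> 2 ^ a * a ^ (a - r)"
    proof (intro mult_right_mono)
      have "card ?T \<le> card (Pow S)" using assms(2) by (intro card_mono) auto
      then show "card ?T \<le> 2 ^ a" using assms(2) by (simp add: card_Pow a_def)
    qed simp
    finally have "real (card P) \<le> real (2 ^ a * a ^ (a - r))" by (simp only: of_nat_le_iff)
    also have "\<dots> = 2 ^ a * (real a ^ a / real a ^ r)"
    proof -
      have "r \<le> a" using ar p by simp
      then have "real a ^ (a - r) = real a ^ a / real a ^ r" using a by (intro power_diff) auto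
      then show ?thesis by simp
    qed
    \<comment> \<open>All cycles in \<open>S\<close> have length \<open>p\<close>, so
      \<open>a = p * r\<close>.\<close>
    also have "real a ^ r = (real a powr (1 / real p)) ^ a"
      using a p by (simp add: ar powr_powr powr_realpow flip: powr_realpow)
    finally show ?thesis by (simp add: a_def power_divide power_mult_distrib)
  qed simp
qed

section \<open>Counting symmetric graphs\<close>

lemma automorphisms_funpow:
  assumes "f \<in> automorphisms n G"
  shows "f ^^ k \<in> automorphisms n G"
proof (induction k)
  case (Suc k)
  have "(\<lambda>e. (f \<circ> f ^^ k) ` e) ` G = (\<lambda>e. f ` e) ` (\<lambda>e. (f ^^ k) ` e) ` G"
    by (simp add: image_image image_comp)
  also have "\<dots> = G" using Suc assms by (simp add: automorphisms_def)
  finally show ?case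
    using Suc assms permutes_compose[of "f ^^ k" "{1..n}" f] by (simp add: automorphisms_def comp_def)
qed (simp add: automorphisms_def flip: id_def)

text \<open>If a nonidentity automorphism has order \<open>k\<close> and the prime \<open>p\<close>
  divides \<open>k\<close>, its power with exponent \<open>k / p\<close> has order
  \<open>p\<close>.\<close>

lemma symmetric_graph_prime_order:
  assumes "symmetric_graph n G"
  obtains p f where "prime p" "f \<in> automorphisms n G" "f \<noteq> id" "f ^^ p = id"
proof -
  have "id \<in> automorphisms n G" by (simp add: automorphisms_def permutes_id)
  with assms obtain f where f: "f \<in> automorphisms n G" "f \<noteq> id"
    by (auto simp: symmetric_graph_def asymmetric_graph_def)
  then have "permutation f" by (auto simp: automorphisms_def permutation_permutes)
  then have ex: "\<exists>k. k > 0 \<and> f ^^ k = id" using permutation_is_nilpotent by blast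
  define k where "k = (LEAST k. k > 0 \<and> f ^^ k = id)"
  have k: "k > 0" "f ^^ k = id" using LeastI_ex[OF ex] by (simp_all add: k_def)
  have least: "f ^^ j \<noteq> id" if "0 < j" "j < k" for j
    using not_less_Least that unfolding k_def by blast
  have "k \<noteq> 1" using k f(2) by auto
  then obtain p where p: "prime p" "p dvd k" using prime_factor_nat by blast
  then obtain j where j: "k = j * p" by (auto simp: dvd_def mult.commute)
  have "0 < j" "j < k" using k(1) prime_gt_1_nat[OF p(1)] by (auto simp: j)
  then have "f ^^ j \<noteq> id" by (rule least)
  moreover have "(f ^^ j) ^^ p = id" using k(2) by (simp add: j funpow_mult mult.commute)
  ultimately show ?thesis using that p(1) automorphisms_funpow[OF f(1)] by blast
qed

text \<open>The value of \<open>r\<close> is chosen so that a pair inside the support has weight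
  \<open>1 / t\<close>, whose \<open>p\<close>-th power is \<open>1 / a\<close> when
  \<open>t = a powr (1 / p)\<close>. The bounds on \<open>A * r / N\<close> treat pairs with one end
  in the support. The last three compare the vertex weights for degrees 1, 2 and at least 3, divided
  by \<open>t\<close>, with the scales on which the numbers of such vertices are measured.\<close>

lemma scale_bounds:
  fixes A N t :: real
  assumes "A \<ge> 1" "N \<ge> A\<^sup>2" "1 \<le> t" "t \<le> sqrt N"
  defines "r \<equiv> sqrt (N / (A * t))"
  shows "r \<ge> 1" "A * r\<^sup>2 / N = 1 / t" "(A * r / N)\<^sup>2 \<le> A / N" "A * r / N \<le> 1"
    "1 / (r * t) \<le> A\<^sup>2 / sqrt N" "1 / (r\<^sup>2 * t) \<le> A\<^sup>2 / N" "N / (r ^ 3 * t) \<le> A\<^sup>2 / sqrt (sqrt N)"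
proof -
  have N: "N \<ge> 1" using assms(1,2) one_le_power[of A 2] by linarith
  have sN: "A \<le> sqrt N" using assms(1,2) by (intro real_le_rsqrt) auto
  have "A * t \<le> sqrt N * sqrt N" using assms sN by (intro mult_mono) (use N in auto)
  then have AtN: "A * t \<le> N" using N by simp
  have r2: "r\<^sup>2 = N / (A * t)" using assms N by (simp add: r_def)
  show r: "r \<ge> 1" using AtN assms by (simp add: r_def)
  show u2: "A * r\<^sup>2 / N = 1 / t" using assms N by (simp add: r2)
  have "(A * r / N)\<^sup>2 = (A * r\<^sup>2 / N) * (A / N)" by (simp add: power2_eq_square)
  also have "\<dots> \<le> 1 * (A / N)" unfolding u2 using assms N by (intro mult_right_mono) auto
  finally show "(A * r / N)\<^sup>2 \<le> A / N" by simp
  have "A * r / N \<le> A * r\<^sup>2 / N"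
    using r N assms(1) by (intro divide_right_mono mult_left_mono) (auto simp: power2_eq_square)
  also have "\<dots> \<le> 1" unfolding u2 using assms by simp
  finally show "A * r / N \<le> 1" .
  have "sqrt N \<le> A\<^sup>2 * (r * t)"
  proof (rule real_le_lsqrt)
    have "(A\<^sup>2 * (r * t))\<^sup>2 = A ^ 3 * t * N"
    proof -
      have "(A\<^sup>2 * (r * t))\<^sup>2 = A ^ 4 * r\<^sup>2 * t\<^sup>2" by (simp add: power_mult_distrib)
      also have "\<dots> = A ^ 3 * t * N"
        unfolding r2 using assms(1,3) by (simp add: power2_eq_square power3_eq_cube power4_eq_xxxx)
      finally show ?thesis .
    qed
    moreover have "1 * N \<le> A ^ 3 * t * N"
      using assms N mult_mono[of 1 "A ^ 3" 1 t] by (intro mult_right_mono) auto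
    ultimately show "N \<le> (A\<^sup>2 * (r * t))\<^sup>2" by simp
  qed (use r assms N in auto)
  then show "1 / (r * t) \<le> A\<^sup>2 / sqrt N" using r assms N by (simp add: field_simps)
  have "r\<^sup>2 * t = N / A" unfolding r2 using assms(1,3) by simp
  moreover have "A \<le> A\<^sup>2" using assms(1) by (simp add: power2_eq_square)
  ultimately show "1 / (r\<^sup>2 * t) \<le> A\<^sup>2 / N" using N by (simp add: divide_right_mono)
  have "sqrt (sqrt N) \<le> A * r"
  proof (rule real_le_lsqrt)
    have "t * sqrt N \<le> sqrt N * sqrt N" using assms N by (intro mult_right_mono) auto
    also have "\<dots> \<le> A * N" using assms N by simp
    finally have "sqrt N \<le> A * N / t" using assms by (simp add: field_simps)
    also have "\<dots> = (A * r)\<^sup>2" 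
      unfolding power_mult_distrib r2 using assms(1,3) by (simp add: power2_eq_square)
    finally show "sqrt N \<le> (A * r)\<^sup>2" .
  qed (use r assms N in auto)
  moreover have "sqrt (sqrt N) > 0" using N by simp
  ultimately have "A / r \<le> A\<^sup>2 / sqrt (sqrt N)"
    using r assms N by (simp add: field_simps power2_eq_square mult_left_mono)
  moreover have "N / (r ^ 3 * t) = A / r"
  proof -
    have "r ^ 3 * t = r * (r\<^sup>2 * t)" by (simp add: power3_eq_cube power2_eq_square)
    then show ?thesis using \<open>r\<^sup>2 * t = N / A\<close> N assms by simp
  qed
  ultimately show "N / (r ^ 3 * t) \<le> A\<^sup>2 / sqrt (sqrt N)" by simp
qed

section \<open>Weights of the pairs that meet the support\<close>

lemma image_funpow:
  fixes f :: "'a \<Rightarrow> 'a"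
  shows "((`) f ^^ k) X = (f ^^ k) ` X"
  by (induction k) (simp_all add: image_comp)

definition touching_pairs :: "nat \<Rightarrow> nat set \<Rightarrow> nat set set" where
  "touching_pairs n S = {e. e \<subseteq> {1..n} \<and> card e = 2 \<and> e \<inter> S \<noteq> {}}"

lemma finite_touching_pairs: "finite (touching_pairs n S)"
  by (rule finite_subset[of _ "Pow {1..n}"]) (auto simp: touching_pairs_def)

text \<open>Three kinds of pairs contribute. Those fixed by \<open>f\<close> have the form
  \<open>{x, f x}\<close>: at most \<open>a\<close>, of weight at most 1. Inside \<open>S\<close>
  there are at most \<open>a * a\<close>, contributing at most \<open>1 / a\<close> each when not
  fixed. In total there are at most \<open>a * n\<close>, and one with a single end in
  \<open>S\<close> contributes at most \<open>A / n\<close>. The three bounds add up to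
  \<open>(2 + A) * a\<close>.\<close>

lemma sum_orbit_weights_le:
  fixes A r :: real
  assumes "prime p" "f permutes {1..n}" "{x. f x \<noteq> x} = S" "S \<noteq> {}"
    and A: "A \<ge> 1" "real n \<ge> A\<^sup>2"
  defines "r \<equiv> sqrt (real n / (A * real (card S) powr (1 / real p)))"
  defines "u \<equiv> \<lambda>e. A / real n * r ^ card (e \<inter> S)"
  shows "(\<Sum>e\<in>touching_pairs n S. if f ` e = e then u e else u e ^ p) \<le> (2 + A) * real (card S)"
    and "r \<ge> 1"
proof -
  define a where "a = card S"
  define t where "t = real a powr (1 / real p)"
  have Sn: "S \<subseteq> {1..n}"
    using assms(2,3) by (auto simp: permutes_def)
  then have finS: "finite S" using finite_subset by blast
  then have a: "a > 0" using assms(4) by (simp add: a_def card_gt_0_iff)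
  have an: "a \<le> n" using card_mono[OF _ Sn] by (simp add: a_def)
  have p: "p \<ge> 2" using assms(1) by (rule prime_ge_2_nat)
  have tp: "t ^ p = real a" using a p by (simp add: t_def powr_powr flip: powr_realpow)
  have t1: "1 \<le> t" using a by (simp add: t_def ge_one_powr_ge_zero)
  have "t \<le> real a powr (1 / 2)" unfolding t_def using a p by (intro powr_mono) (auto simp: field_simps)
  also have "\<dots> \<le> sqrt (real n)" using an by (simp add: powr_half_sqrt)
  finally have tn: "t \<le> sqrt (real n)" .
  have r: "r = sqrt (real n / (A * t))" by (simp add: r_def t_def a_def)
  note sb = scale_bounds[OF A t1 tn, folded r]
  show "r \<ge> 1" by (rule sb)
  let ?E = "touching_pairs n S"
  let ?b = "\<lambda>e. of_bool (f ` e = e) + of_bool (e \<subseteq> S) * (1 / real a) + A / real n"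
  have bound: "(if f ` e = e then u e else u e ^ p) \<le> ?b e" if e: "e \<in> ?E" for e
  proof -
    obtain x y where xy: "e = {x, y}" "x \<noteq> y" "x \<in> S"
      using e unfolding touching_pairs_def card_2_iff by blast
    have An: "A / real n \<ge> 0" using A by simp
    show ?thesis
    proof (cases "e \<subseteq> S")
      case True
      then have "e \<inter> S = e" by blast
      then have u: "u e = 1 / t" using sb(2) xy by (simp add: u_def power2_eq_square)
      show ?thesis
      proof (cases "f ` e = e")
        case True then show ?thesis using u t1 An by (simp add: add_increasing2)
      next
        case False
        have "u e ^ p = 1 / real a" by (simp add: u power_divide tp)
        then show ?thesis using False True An by simp
      qed
    next
      case False
      then have "y \<notin> S" using xy by blast
      then have "e \<inter> S = {x}" using xy by blast
      then have u: "u e = A * r / real n" by (simp add: u_def)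
      \<comment> \<open>Otherwise \<open>f\<close> would map the moved end \<open>x\<close> to the
        fixed end \<open>y\<close>, against injectivity.\<close>
      have "f ` e \<noteq> e"
      proof
        assume "f ` e = e"
        then have "f x \<in> {x, y}" using xy by blast
        moreover have "f x \<noteq> x" "f y = y" using xy(3) \<open>y \<notin> S\<close> assms(3) by blast+
        ultimately have "f x = f y" by simp
        then show False using permutes_inj[OF assms(2)] xy(2) by (simp add: inj_eq)
      qed
      \<comment> \<open>The weight is at most 1 and \<open>p \<ge> 2\<close>, so the square suffices
        for every prime.\<close>
      moreover have "u e ^ p \<le> u e ^ 2"
        using u sb(1,4) A p by (intro power_decreasing) auto
      ultimately show ?thesis using False sb(3) u by simp
    qed
  qed
  have cardE: "card ?E \<le> a * n"
  proof -
    have "?E \<subseteq> (\<lambda>(x, y). {x, y}) ` (S \<times> {1..n})"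
    proof
      fix e assume e: "e \<in> ?E"
      obtain x y where xy: "e = {x, y}" "x \<in> S"
        using e unfolding touching_pairs_def card_2_iff by blast
      moreover have "y \<in> {1..n}" using e xy unfolding touching_pairs_def by blast
      ultimately show "e \<in> (\<lambda>(x, y). {x, y}) ` (S \<times> {1..n})" by (intro image_eqI[of _ _ "(x, y)"]) auto
    qed
    then have "card ?E \<le> card (S \<times> {1..n})" using finS by (intro surj_card_le) auto
    then show ?thesis by (simp add: a_def card_cartesian_product)
  qed
  have cardS: "card {e \<in> ?E. e \<subseteq> S} \<le> a * a"
  proof -
    have "{e \<in> ?E. e \<subseteq> S} \<subseteq> (\<lambda>(x, y). {x, y}) ` (S \<times> S)"
    proof
      fix e assume e: "e \<in> {e \<in> ?E. e \<subseteq> S}"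
      obtain x y where xy: "e = {x, y}"
        using e unfolding touching_pairs_def card_2_iff by blast
      then show "e \<in> (\<lambda>(x, y). {x, y}) ` (S \<times> S)" using e by (intro image_eqI[of _ _ "(x, y)"]) auto
    qed
    then have "card {e \<in> ?E. e \<subseteq> S} \<le> card (S \<times> S)" using finS by (intro surj_card_le) auto
    then show ?thesis by (simp add: a_def card_cartesian_product)
  qed
  have cardF: "card {e \<in> ?E. f ` e = e} \<le> a"
  proof -
    have "{e \<in> ?E. f ` e = e} \<subseteq> (\<lambda>x. {x, f x}) ` S"
    proof
      fix e assume e: "e \<in> {e \<in> ?E. f ` e = e}"
      obtain x y where xy: "e = {x, y}" "x \<in> S"
        using e unfolding touching_pairs_def card_2_iff by blast
      have "f x \<noteq> x" using xy assms(3) by blast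
      moreover have "f x \<in> {x, y}" using e xy by blast
      ultimately have "e = {x, f x}" using xy by blast
      then show "e \<in> (\<lambda>x. {x, f x}) ` S" using xy by blast
    qed
    then show ?thesis unfolding a_def by (intro surj_card_le finS)
  qed
  have fin: "finite ?E" by (rule finite_touching_pairs)
  have "(\<Sum>e\<in>?E. if f ` e = e then u e else u e ^ p) \<le> (\<Sum>e\<in>?E. ?b e)"
    by (intro sum_mono bound)
  also have "\<dots> = real (card {e \<in> ?E. f ` e = e}) + real (card {e \<in> ?E. e \<subseteq> S}) * (1 / real a)
      + real (card ?E) * (A / real n)"
    using fin by (simp add: sum.distrib Int_def flip: sum_distrib_right sum_divide_distrib)
  also have "\<dots> \<le> real a + real (a * a) * (1 / real a) + real (a * n) * (A / real n)"
    using cardE cardS cardF A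
    by (intro add_mono mult_right_mono) (simp_all only: of_nat_le_iff, auto)
  also have "\<dots> = (2 + A) * real a" using a an by (simp add: field_simps)
  finally show "(\<Sum>e\<in>?E. if f ` e = e then u e else u e ^ p) \<le> (2 + A) * real (card S)"
    by (simp add: a_def)
qed

context bounded_degrees
begin

text \<open>If \<open>f\<close> is an automorphism of \<open>G\<close>, the edges of
  \<open>G\<close> that meet \<open>S\<close> form an invariant set \<open>F\<close>, and graphs
  containing \<open>F\<close> have proportion at most \<open>q ^ card F\<close>. Since
  \<open>F\<close> has exactly the sum of the degrees in \<open>S\<close> as its number of edge ends
  in \<open>S\<close>, this power splits into a factor for every vertex of \<open>S\<close> and a
  factor \<open>u e\<close> for every edge. Degrees above 3 are cut off at 3, which only weakens the
  bound as \<open>r \<ge> 1\<close>.\<close>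

lemma card_graphs_with_automorphism:
  fixes r :: real
  assumes "prime p" "f permutes {1..n}" "f ^^ p = id" "{x. f x \<noteq> x} = S" "n > 0" "r \<ge> 1"
  defines "u \<equiv> \<lambda>e. 4 * exp 1 * (real (D + 1))\<^sup>2 / real n * r ^ card (e \<inter> S)"
  shows "real (card {G \<in> GG. f \<in> automorphisms n G}) \<le> real (card GG) * (\<Prod>s\<in>S. 1 / r ^ min (d s) 3) *
     exp (\<Sum>e\<in>touching_pairs n S. if f ` e = e then u e else u e ^ p)"
proof -
  let ?E = "touching_pairs n S" and ?Aut = "{G \<in> GG. f \<in> automorphisms n G}"
  define q where "q = 4 * exp 1 * (real (D + 1))\<^sup>2 / real n"
  have q: "q > 0" using assms(5) by (simp add: q_def)
  have u: "u e = q * r ^ card (e \<inter> S)" for e by (simp add: u_def q_def)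
  have Sn: "S \<subseteq> {1..n}" using assms(2,4) by (auto simp: permutes_def)
  then have finS: "finite S" using finite_subset by blast
  have inj: "inj f" using assms(2) by (rule permutes_inj)
  have fS: "f x \<in> S \<longleftrightarrow> x \<in> S" for x using assms(4) inj by (auto simp: inj_eq)
  have image_Int: "f ` e \<inter> S = f ` (e \<inter> S)" for e using fS by blast
  have card_Int: "card (f ` e \<inter> S) = card (e \<inter> S)" for e
    unfolding image_Int by (intro card_image inj_on_subset[OF inj]) simp
  define I where "I = {F. F \<subseteq> ?E \<and> (\<lambda>e. f ` e) ` F \<subseteq> F}"
  define J where "J = {F \<in> I. (\<Sum>e\<in>F. card (e \<inter> S)) = (\<Sum>s\<in>S. d s)}"
  have finI: "finite I" unfolding I_def
    by (rule finite_subset[of _ "Pow ?E"]) (use finite_touching_pairs in auto)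
  then have finJ: "finite J" by (simp add: J_def)
  have fE: "f ` e \<in> ?E" if "e \<in> ?E" for e
  proof -
    have "card (f ` e) = card e" by (intro card_image inj_on_subset[OF inj]) simp
    moreover have "f ` e \<subseteq> {1..n}" using that permutes_image[OF assms(2)] by (auto simp: touching_pairs_def)
    moreover have "f ` e \<inter> S \<noteq> {}" using that by (simp add: image_Int touching_pairs_def)
    ultimately show ?thesis using that by (simp add: touching_pairs_def)
  qed
  have "G \<inter> ?E \<in> J" if G: "G \<in> ?Aut" for G
  proof -
    have GG: "G \<in> GG" "(\<lambda>e. f ` e) ` G = G" using G by (auto simp: automorphisms_def)
    then have "G \<inter> ?E \<in> I" using fE by (auto simp: I_def)
    moreover have "(\<Sum>e\<in>G \<inter> ?E. card (e \<inter> S)) = (\<Sum>s\<in>S. d s)"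
    proof -
      have fin: "finite (G \<inter> ?E)" using finite_touching_pairs by simp
      have "(\<Sum>e\<in>G \<inter> ?E. card (e \<inter> S)) = (\<Sum>e\<in>G \<inter> ?E. \<Sum>s\<in>S. of_bool (s \<in> e))"
        using finS by (intro sum.cong refl) (simp add: Int_def conj_commute)
      also have "\<dots> = (\<Sum>s\<in>S. \<Sum>e\<in>G \<inter> ?E. of_bool (s \<in> e))" by (rule sum.swap)
      also have "\<dots> = (\<Sum>s\<in>S. d s)"
      proof (rule sum.cong[OF refl])
        fix s assume s: "s \<in> S"
        have "{e \<in> G \<inter> ?E. s \<in> e} = {e \<in> G. s \<in> e}"
          using simple[OF GG(1)] s by (auto simp: simple_graphs_def touching_pairs_def)
        then have "(\<Sum>e\<in>G \<inter> ?E. of_bool (s \<in> e)) = vertex_degree G s"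
          using fin by (simp add: vertex_degree_def Int_def)
        also have "\<dots> = d s" using GG(1) s Sn by (auto simp: graphs_with_degrees_def)
        finally show "(\<Sum>e\<in>G \<inter> ?E. of_bool (s \<in> e)) = d s" .
      qed
      finally show ?thesis .
    qed
    ultimately show ?thesis by (simp add: J_def)
  qed
  then have "?Aut \<subseteq> (\<Union>F\<in>J. {G \<in> GG. F \<subseteq> G})" by blast
  then have "card ?Aut \<le> card (\<Union>F\<in>J. {G \<in> GG. F \<subseteq> G})"
    using finJ finite_graphs_with_degrees by (intro card_mono) auto
  also have "\<dots> \<le> (\<Sum>F\<in>J. card {G \<in> GG. F \<subseteq> G})" using finJ by (rule card_UN_le)
  finally have "real (card ?Aut) \<le> (\<Sum>F\<in>J. real (card {G \<in> GG. F \<subseteq> G}))"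
    by (simp only: flip: of_nat_sum of_nat_le_iff[where 'a = real])
  also have "\<dots> \<le> (\<Sum>F\<in>J. real (card GG) * ((\<Prod>s\<in>S. 1 / r ^ d s) * (\<Prod>e\<in>F. u e)))"
  proof (rule sum_mono)
    fix F assume F: "F \<in> J"
    then have finF: "finite F"
      using finite_touching_pairs by (auto simp: J_def I_def intro: finite_subset)
    have "(\<Prod>e\<in>F. u e) = q ^ card F * r ^ (\<Sum>e\<in>F. card (e \<inter> S))"
      by (simp add: u prod.distrib power_sum)
    also have "(\<Sum>e\<in>F. card (e \<inter> S)) = (\<Sum>s\<in>S. d s)" using F by (simp add: J_def)
    also have "r ^ (\<Sum>s\<in>S. d s) = (\<Prod>s\<in>S. r ^ d s)" by (simp add: power_sum)
    \<comment> \<open>By the degree condition in \<open>J\<close>, the powers of \<open>r\<close> in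
      the edge weights cancel those in the vertex weights.\<close>
    finally have "(\<Prod>s\<in>S. 1 / r ^ d s) * (\<Prod>e\<in>F. u e) = q ^ card F * (\<Prod>s\<in>S. 1 / r ^ d s * r ^ d s)"
      by (simp only: prod.distrib mult_ac)
    also have "(\<Prod>s\<in>S. 1 / r ^ d s * r ^ d s) = 1" using assms(6) by (intro prod.neutral) auto
    finally have "(\<Prod>s\<in>S. 1 / r ^ d s) * (\<Prod>e\<in>F. u e) = q ^ card F" by simp
    then show "real (card {G \<in> GG. F \<subseteq> G}) \<le> real (card GG) * ((\<Prod>s\<in>S. 1 / r ^ d s) * (\<Prod>e\<in>F. u e))"
      using card_graphs_containing[OF finF assms(5)] by (simp add: q_def mult.commute)
  qed
  also have "\<dots> = real (card GG) * ((\<Prod>s\<in>S. 1 / r ^ d s) * (\<Sum>F\<in>J. \<Prod>e\<in>F. u e))"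
    by (simp add: sum_distrib_left)
  also have "\<dots> \<le> real (card GG) * ((\<Prod>s\<in>S. 1 / r ^ min (d s) 3) *
     exp (\<Sum>e\<in>?E. if f ` e = e then u e else u e ^ p))"
  proof (intro mult_left_mono mult_mono)
    show "(\<Prod>s\<in>S. 1 / r ^ d s) \<le> (\<Prod>s\<in>S. 1 / r ^ min (d s) 3)"
      using assms(6) by (intro prod_mono conjI divide_left_mono power_increasing) auto
    have u0: "u e \<ge> 0" for e using q assms(6) by (simp add: u)
    \<comment> \<open>The degree condition has been converted into the factor in \<open>r\<close>,
      so it can now be dropped in favour of all invariant sets.\<close>
    have "(\<Sum>F\<in>J. \<Prod>e\<in>F. u e) \<le> (\<Sum>F\<in>I. \<Prod>e\<in>F. u e)"
      using finI u0 by (intro sum_mono2 prod_nonneg) (auto simp: J_def)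
    also have "\<dots> \<le> exp (\<Sum>e\<in>?E. if f ` e = e then u e else u e ^ p)"
      unfolding I_def
    proof (rule sum_invariant_sets_le_exp[OF assms(1) _ finite_touching_pairs fE u0])
      show "(`) f ^^ p = id" by (rule ext) (simp add: image_funpow assms(3))
      show "u (f ` e) = u e" for e by (simp add: u card_Int)
    qed
    finally show "(\<Sum>F\<in>J. \<Prod>e\<in>F. u e) \<le> exp (\<Sum>e\<in>?E. if f ` e = e then u e else u e ^ p)" .
    show "0 \<le> (\<Sum>F\<in>J. \<Prod>e\<in>F. u e)" using u0 by (intro sum_nonneg prod_nonneg) auto
  qed (use assms(6) in \<open>auto intro!: prod_nonneg\<close>)
  finally show ?thesis by (simp add: mult.assoc)
qed

text \<open>A union bound over the size \<open>a\<close> of the support, the prime order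
  \<open>p\<close>, the support \<open>S\<close> and the permutation \<open>f\<close>. The bases of
  the \<open>a\<close>-th powers are \<open>2 * a / t\<close> for the choice of \<open>f\<close>,
  \<open>exp (2 + A)\<close> for the orbit weights and \<open>exp 1 * W / a\<close> for the choice
  of \<open>S\<close>, where \<open>W\<close> is the total vertex weight; the factors
  \<open>a\<close> cancel. The remaining factor \<open>a\<close> in the sum bounds the number of
  primes up to \<open>a\<close>.\<close>

lemma card_symmetric_le:
  fixes A :: real
  assumes A: "A = 4 * exp 1 * (real (D + 1))\<^sup>2" and n: "real n \<ge> A\<^sup>2"
  defines "\<eta> \<equiv> real (degree_count n d 1) / sqrt (real n) + real (degree_count n d 2) / real n + 1 / sqrt (sqrt (real n))"
  shows "real (card {G \<in> GG. symmetric_graph n G}) \<le>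
    real (card GG) * (\<Sum>a=1..n. real a * (2 * exp (3 + A) * A\<^sup>2 * \<eta>) ^ a)"
proof -
  let ?V = "{1..n}"
  define M where "M p S = {f. f ^^ p = id \<and> {x. f x \<noteq> x} = S}" for p and S :: "nat set"
  define U where "U p S = {G \<in> GG. \<exists>f\<in>M p S. f \<in> automorphisms n G}" for p S
  let ?primes = "\<lambda>a::nat. {p. prime p \<and> p \<le> a}" and ?sets = "\<lambda>a. {S. S \<subseteq> ?V \<and> card S = a}"
  have "1 \<le> exp (1::real)" by simp
  then have "1 * 1 \<le> 4 * exp 1 * (real (D + 1))\<^sup>2"
    by (intro mult_mono one_le_power) linarith+
  then have A1: "A \<ge> 1" using A by simp
  then have n0: "n > 0" using n by (metis gr0I linorder_not_le of_nat_0 one_le_power order_trans zero_less_one)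
  have fin_sets: "finite (?sets a)" for a by (rule finite_subset[of _ "Pow ?V"]) auto
  have sub: "{G \<in> GG. symmetric_graph n G} \<subseteq> (\<Union>a\<in>?V. \<Union>p\<in>?primes a. \<Union>S\<in>?sets a. U p S)"
  proof
    fix G assume "G \<in> {G \<in> GG. symmetric_graph n G}"
    then have G: "G \<in> GG" "symmetric_graph n G" by auto
    obtain p f where pf: "prime p" "f \<in> automorphisms n G" "f \<noteq> id" "f ^^ p = id"
      using symmetric_graph_prime_order[OF G(2)] .
    define S where "S = {x. f x \<noteq> x}"
    have "f permutes ?V" using pf(2) by (simp add: automorphisms_def)
    then have SV: "S \<subseteq> ?V" by (auto simp: S_def permutes_def)
    then have finS: "finite S" using finite_subset by blast
    obtain x where x: "f x \<noteq> x" using pf(3) by (metis eq_id_iff)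
    have "inj f" using \<open>f permutes ?V\<close> by (rule permutes_inj)
    \<comment> \<open>A nontrivial cycle has \<open>p\<close> elements and lies in the support,
      hence \<open>p \<le> card S\<close>.\<close>
    then have "iterates f x \<subseteq> S" by (intro iterates_closed) (use x in \<open>auto simp: S_def inj_eq\<close>)
    then have "p \<le> card S" using card_mono[OF finS] card_iterates[of p f x] pf x by metis
    moreover have "card S \<le> n" using card_mono[OF _ SV] by simp
    moreover have "p > 0" using pf(1) by (rule prime_gt_0_nat)
    moreover have "G \<in> U p S" using G pf by (auto simp: U_def M_def S_def)
    ultimately show "G \<in> (\<Union>a\<in>?V. \<Union>p\<in>?primes a. \<Union>S\<in>?sets a. U p S)"
      using SV pf(1) by (intro UN_I[of "card S"] UN_I[of p] UN_I[of S]) auto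
  qed
  have step: "(\<Sum>S\<in>?sets a. real (card (U p S))) \<le> real (card GG) * (2 * exp (3 + A) * A\<^sup>2 * \<eta>) ^ a"
    if a: "a \<in> ?V" and p: "p \<in> ?primes a" for a p
  proof -
    have a0: "a > 0" "a \<le> n" using a by auto
    have pp: "prime p" using p by simp
    define t where "t = real a powr (1 / real p)"
    define r where "r = sqrt (real n / (A * t))"
    define w where "w s = 1 / r ^ min (d s) 3" for s
    have "p \<ge> 2" using pp by (rule prime_ge_2_nat)
    have t1: "1 \<le> t" using a0 by (simp add: t_def ge_one_powr_ge_zero)
    have "t \<le> real a powr (1 / 2)"
      unfolding t_def using a0 \<open>p \<ge> 2\<close> by (intro powr_mono) (auto simp: field_simps)
    also have "\<dots> \<le> sqrt (real n)" using a0 by (simp add: powr_half_sqrt)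
    finally have tn: "t \<le> sqrt (real n)" .
    note sb = scale_bounds[OF A1 n t1 tn, folded r_def]
    have w0: "w s > 0" for s using sb(1) by (simp add: w_def)
    have U: "real (card (U p S)) \<le> real (card GG) * (2 * real a / t) ^ a * exp (2 + A) ^ a * (\<Prod>s\<in>S. w s)"
      if S: "S \<in> ?sets a" for S
    proof -
      have S': "S \<subseteq> ?V" "card S = a" "finite S" "S \<noteq> {}" using S a0 by (auto intro: finite_subset)
      note M = card_prime_order_permutations[OF pp S'(3,4), folded M_def]
      have Aut: "real (card {G \<in> GG. f \<in> automorphisms n G}) \<le> real (card GG) * (\<Prod>s\<in>S. w s) * exp (2 + A) ^ a"
        if f: "f \<in> M p S" for f
      proof (cases "f permutes ?V")
        case True
        have f': "f ^^ p = id" "{x. f x \<noteq> x} = S" using f by (simp_all add: M_def)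
        note so = sum_orbit_weights_le[OF pp True f'(2) S'(4) A1 n, unfolded S'(2), folded t_def, folded r_def]
        have "real (card {G \<in> GG. f \<in> automorphisms n G}) \<le> real (card GG) * (\<Prod>s\<in>S. w s) *
          exp (\<Sum>e\<in>touching_pairs n S. if f ` e = e then A / real n * r ^ card (e \<inter> S) else (A / real n * r ^ card (e \<inter> S)) ^ p)"
          using card_graphs_with_automorphism[OF pp True f' n0 so(2)] by (simp only: A w_def)
        also have "\<dots> \<le> real (card GG) * (\<Prod>s\<in>S. w s) * exp (real a * (2 + A))"
          using so(1) w0 by (intro mult_left_mono mult_nonneg_nonneg prod_nonneg) (auto simp: mult.commute less_imp_le)
        also have "exp (real a * (2 + A)) = exp (2 + A) ^ a" by (rule exp_of_nat_mult)
        finally show ?thesis .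
      next
        case False
        then have none: "{G \<in> GG. f \<in> automorphisms n G} = {}" by (auto simp: automorphisms_def)
        show ?thesis unfolding none using w0 by (auto intro!: mult_nonneg_nonneg prod_nonneg simp: less_imp_le)
      qed
      have "U p S = (\<Union>f\<in>M p S. {G \<in> GG. f \<in> automorphisms n G})" by (auto simp: U_def)
      then have "card (U p S) \<le> (\<Sum>f\<in>M p S. card {G \<in> GG. f \<in> automorphisms n G})"
        using card_UN_le[OF M(1)] by simp
      then have "real (card (U p S)) \<le> (\<Sum>f\<in>M p S. real (card {G \<in> GG. f \<in> automorphisms n G}))"
        by (simp only: flip: of_nat_sum of_nat_le_iff[where 'a = real])
      also have "\<dots> \<le> (\<Sum>f\<in>M p S. real (card GG) * (\<Prod>s\<in>S. w s) * exp (2 + A) ^ a)"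
        by (intro sum_mono Aut)
      also have "\<dots> = real (card (M p S)) * (real (card GG) * (\<Prod>s\<in>S. w s) * exp (2 + A) ^ a)" by simp
      also have "\<dots> \<le> (2 * real a / t) ^ a * (real (card GG) * (\<Prod>s\<in>S. w s) * exp (2 + A) ^ a)"
        using M(2) w0 unfolding S'(2) t_def
        by (intro mult_right_mono mult_nonneg_nonneg prod_nonneg) (auto simp: less_imp_le)
      finally show ?thesis by (simp only: mult_ac)
    qed
    define W where "W = sum w ?V"
    have W0: "W > 0" unfolding W_def using w0 n0 by (intro sum_pos) auto
    have "(\<Sum>S\<in>?sets a. real (card (U p S))) \<le>
        (\<Sum>S\<in>?sets a. real (card GG) * (2 * real a / t) ^ a * exp (2 + A) ^ a * (\<Prod>s\<in>S. w s))"
      by (intro sum_mono U)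
    also have "\<dots> = real (card GG) * (2 * real a / t) ^ a * exp (2 + A) ^ a * (\<Sum>S\<in>?sets a. \<Prod>s\<in>S. w s)"
      by (simp only: sum_distrib_left)
    also have "\<dots> \<le> real (card GG) * (2 * real a / t) ^ a * exp (2 + A) ^ a * (exp 1 * W / real a) ^ a"
      unfolding W_def using w0 W0 a0 t1
      by (intro mult_left_mono sum_subsets_card_prod_le) (auto simp: W_def less_imp_le)
    also have "\<dots> = real (card GG) * (2 * real a / t * exp (2 + A) * (exp 1 * W / real a)) ^ a"
      by (simp only: power_mult_distrib mult.assoc)
    also have "2 * real a / t * exp (2 + A) * (exp 1 * W / real a) = 2 * (exp (2 + A) * exp 1) * (W / t)"
      using a0 t1 by (simp add: field_simps)
    also have "exp (2 + A) * exp 1 = exp (3 + A)" by (simp flip: exp_add)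
    also have "real (card GG) * (2 * exp (3 + A) * (W / t)) ^ a \<le> real (card GG) * (2 * exp (3 + A) * (A\<^sup>2 * \<eta>)) ^ a"
    proof (intro mult_left_mono power_mono)
      \<comment> \<open>The last term is charged to every vertex and covers all degrees from 3 on,
        where \<open>min (d s) 3 = 3\<close>.\<close>
      have ws: "w s \<le> of_bool (d s = 1) * (1 / r) + of_bool (d s = 2) * (1 / r\<^sup>2) + 1 / r ^ 3" if "s \<in> ?V" for s
      proof -
        have "1 \<le> d s" using degree_bounds[OF that] by simp
        then consider "d s = 1" | "d s = 2" | "d s \<ge> 3" by linarith
        then show ?thesis using sb(1) by cases (auto simp: w_def)
      qed
      have "W \<le> (\<Sum>s\<in>?V. of_bool (d s = 1) * (1 / r) + of_bool (d s = 2) * (1 / r\<^sup>2) + 1 / r ^ 3)"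
        unfolding W_def by (intro sum_mono ws)
      also have "\<dots> = real (degree_count n d 1) * (1 / r) + real (degree_count n d 2) * (1 / r\<^sup>2) + real n * (1 / r ^ 3)"
        by (simp add: sum.distrib degree_count_def Int_def flip: sum_distrib_right sum_divide_distrib)
      finally have "W / t \<le> (real (degree_count n d 1) * (1 / r) + real (degree_count n d 2) * (1 / r\<^sup>2) + real n * (1 / r ^ 3)) / t"
        using t1 by (intro divide_right_mono) auto
      also have "\<dots> = real (degree_count n d 1) * (1 / (r * t)) + real (degree_count n d 2) * (1 / (r\<^sup>2 * t)) + real n / (r ^ 3 * t)"
        by (simp add: add_divide_distrib)
      also have "\<dots> \<le> real (degree_count n d 1) * (A\<^sup>2 / sqrt (real n)) + real (degree_count n d 2) * (A\<^sup>2 / real n) + A\<^sup>2 / sqrt (sqrt (real n))"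
        by (intro add_mono mult_left_mono sb) auto
      also have "\<dots> = A\<^sup>2 * \<eta>" by (simp add: \<eta>_def algebra_simps)
      finally show "W / t \<le> A\<^sup>2 * \<eta>" .
    qed (use W0 t1 in auto)
    finally show ?thesis by (simp only: mult.assoc)
  qed
  have fin_primes: "finite (?primes a)" for a :: nat by (rule finite_subset[of _ "{..a}"]) auto
  have \<eta>0: "2 * exp (3 + A) * A\<^sup>2 * \<eta> \<ge> 0" by (simp add: \<eta>_def)
  have finU: "finite (\<Union>a\<in>?V. \<Union>p\<in>?primes a. \<Union>S\<in>?sets a. U p S)"
    by (rule finite_subset[OF _ finite_graphs_with_degrees[of n d]]) (auto simp: U_def)
  have "card {G \<in> GG. symmetric_graph n G} \<le> card (\<Union>a\<in>?V. \<Union>p\<in>?primes a. \<Union>S\<in>?sets a. U p S)"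
    using finU sub by (rule card_mono)
  also have "\<dots> \<le> (\<Sum>a\<in>?V. card (\<Union>p\<in>?primes a. \<Union>S\<in>?sets a. U p S))"
    by (rule card_UN_le) simp
  also have "\<dots> \<le> (\<Sum>a\<in>?V. \<Sum>p\<in>?primes a. card (\<Union>S\<in>?sets a. U p S))"
    by (intro sum_mono card_UN_le fin_primes)
  also have "\<dots> \<le> (\<Sum>a\<in>?V. \<Sum>p\<in>?primes a. \<Sum>S\<in>?sets a. card (U p S))"
    by (intro sum_mono card_UN_le fin_sets)
  finally have "real (card {G \<in> GG. symmetric_graph n G}) \<le> (\<Sum>a\<in>?V. \<Sum>p\<in>?primes a. \<Sum>S\<in>?sets a. real (card (U p S)))"
    by (simp only: flip: of_nat_sum of_nat_le_iff[where 'a = real])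
  also have "\<dots> \<le> (\<Sum>a\<in>?V. \<Sum>p\<in>?primes a. real (card GG) * (2 * exp (3 + A) * A\<^sup>2 * \<eta>) ^ a)"
    by (intro sum_mono step)
  also have "\<dots> \<le> (\<Sum>a\<in>?V. real a * (real (card GG) * (2 * exp (3 + A) * A\<^sup>2 * \<eta>) ^ a))"
  proof (rule sum_mono)
    fix a :: nat
    have "card (?primes a) \<le> card {1..a}"
      using prime_gt_0_nat by (intro card_mono) (auto simp: Suc_le_eq)
    then show "(\<Sum>p\<in>?primes a. real (card GG) * (2 * exp (3 + A) * A\<^sup>2 * \<eta>) ^ a) \<le>
        real a * (real (card GG) * (2 * exp (3 + A) * A\<^sup>2 * \<eta>) ^ a)"
      using \<eta>0 by (simp only: sum_constant) (intro mult_right_mono mult_nonneg_nonneg, auto)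
  qed
  also have "\<dots> = real (card GG) * (\<Sum>a=1..n. real a * (2 * exp (3 + A) * A\<^sup>2 * \<eta>) ^ a)"
    by (simp only: sum_distrib_left mult.left_commute)
  finally show ?thesis .
qed

end

section \<open>Limits\<close>

context bounded_degrees
begin

text \<open>An asymmetric graph has no edge between leaves. The hypothesis makes the factor
  \<open>k - (D + D\<^sup>2)\<close> in the switching bound at least \<open>k / 2\<close>.\<close>

lemma card_asymmetric_leaves:
  assumes "degree_count n d 1 \<ge> 2 * (D + D\<^sup>2)"
  shows "(real (degree_count n d 1))\<^sup>2 * real (card {G \<in> GG. asymmetric_graph n G})
    \<le> 4 * real D * real n * real (card {G \<in> GG. symmetric_graph n G})"
proof -
  let ?k = "degree_count n d 1" and ?sym = "card {G \<in> GG. symmetric_graph n G}"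
  let ?A = "{G \<in> GG. leaf_arcs G = {}}"
  have k: "card leaves = ?k" by (simp add: leaves_def degree_count_def)
  have "card {G \<in> GG. asymmetric_graph n G} \<le> card ?A"
    using leaf_arcs_symmetric finite_graphs_with_degrees[of n d]
    by (intro card_mono) (auto simp: symmetric_graph_def)
  then have "?k\<^sup>2 * card {G \<in> GG. asymmetric_graph n G} \<le> ?k\<^sup>2 * card ?A" by simp
  also have "\<dots> \<le> 2 * (?k * (?k - (D + D\<^sup>2))) * card ?A"
  proof (rule mult_right_mono)
    have "?k * ?k \<le> ?k * (2 * (?k - (D + D\<^sup>2)))"
      using assms by (intro mult_left_mono) arith+
    then show "?k\<^sup>2 \<le> 2 * (?k * (?k - (D + D\<^sup>2)))"
      by (simp only: power2_eq_square mult_ac)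
  qed simp
  also have "\<dots> \<le> 2 * (2 * (D * n) * card {G \<in> GG. leaf_arcs G \<noteq> {} \<and> card (leaf_arcs G) \<le> 2})"
    using leaf_switching unfolding k by simp
  also have "\<dots> \<le> 2 * (2 * (D * n) * ?sym)"
    using leaf_arcs_symmetric finite_graphs_with_degrees[of n d]
    by (intro mult_left_mono card_mono) auto
  also have "\<dots> = 4 * D * n * ?sym" by simp
  finally have "real (?k\<^sup>2 * card {G \<in> GG. asymmetric_graph n G}) \<le> real (4 * D * n * ?sym)"
    by (simp only: of_nat_le_iff)
  then show ?thesis by simp
qed

text \<open>An asymmetric graph has no triangle component on vertices of degree 2. The hypothesis
  makes both reduced factors in the switching bound at least \<open>k / 2\<close>, whence
  \<open>648 = 4 * 162\<close>.\<close>

lemma card_asymmetric_triangles: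
  assumes "degree_count n d 2 \<ge> 4 * (D + 1) ^ 3"
  shows "real (degree_count n d 2) ^ 3 * real (card {G \<in> GG. asymmetric_graph n G})
    \<le> 648 * real D ^ 3 * real n ^ 3 * real (card {G \<in> GG. symmetric_graph n G})"
proof -
  let ?k = "degree_count n d 2" and ?sym = "card {G \<in> GG. symmetric_graph n G}"
  let ?A = "{G \<in> GG. triangles G = {}}"
  define K where "K = (D + 1) ^ 3"
  have k: "?k = card {i \<in> {1..n}. d i = 2}" by (simp add: degree_count_def)
  have kK: "?k \<ge> 4 * K" using assms by (simp add: K_def)
  have "card {G \<in> GG. asymmetric_graph n G} \<le> card ?A"
    using triangles_symmetric finite_graphs_with_degrees[of n d]
    by (intro card_mono) (auto simp: symmetric_graph_def)
  then have "?k ^ 3 * card {G \<in> GG. asymmetric_graph n G} \<le> ?k ^ 3 * card ?A" by simp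
  also have "\<dots> \<le> 4 * (?k * ((?k - K) * (?k - 2 * K))) * card ?A"
  proof (rule mult_right_mono)
    have "?k * (?k * ?k) \<le> ?k * ((2 * (?k - K)) * (2 * (?k - 2 * K)))"
      using kK by (intro mult_left_mono mult_mono) auto
    also have "\<dots> = 4 * (?k * ((?k - K) * (?k - 2 * K)))" by (simp only: mult_ac)
    finally show "?k ^ 3 \<le> 4 * (?k * ((?k - K) * (?k - 2 * K)))"
      by (simp only: power3_eq_cube mult.assoc)
  qed simp
  also have "\<dots> \<le> 4 * (162 * (D * n) ^ 3 * card {G \<in> GG. triangles G \<noteq> {} \<and> card (triangles G) \<le> 6})"
    using mult_le_mono2[OF triangle_switching[OF k], of 4] unfolding K_def by (simp only: mult.assoc)
  also have "\<dots> \<le> 4 * (162 * (D * n) ^ 3 * ?sym)"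
    using triangles_symmetric finite_graphs_with_degrees[of n d]
    by (intro mult_left_mono card_mono) auto
  also have "\<dots> = 648 * D ^ 3 * n ^ 3 * ?sym" by (simp add: power_mult_distrib)
  finally have "real (?k ^ 3 * card {G \<in> GG. asymmetric_graph n G}) \<le> real (648 * D ^ 3 * n ^ 3 * ?sym)"
    by (simp only: of_nat_le_iff)
  then show ?thesis by simp
qed

lemma card_asymmetric_plus_symmetric:
  "card {G \<in> GG. asymmetric_graph n G} + card {G \<in> GG. symmetric_graph n G} = card GG"
proof -
  have "card ({G \<in> GG. asymmetric_graph n G} \<union> {G \<in> GG. symmetric_graph n G}) =
      card {G \<in> GG. asymmetric_graph n G} + card {G \<in> GG. symmetric_graph n G}"
    using finite_graphs_with_degrees[of n d]
    by (intro card_Un_disjoint) (auto simp: symmetric_graph_def)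
  moreover have "{G \<in> GG. asymmetric_graph n G} \<union> {G \<in> GG. symmetric_graph n G} = GG"
    by (auto simp: symmetric_graph_def)
  ultimately show ?thesis by simp
qed

end

section \<open>Probabilities and limits along the index set\<close>

lemma prob_random_graph:
  assumes "graphical n d"
  shows "measure_pmf.prob (random_graph n d) {E. Q E} =
    real (card {G \<in> graphs_with_degrees n d. Q G}) / real (card (graphs_with_degrees n d))"
    and "card (graphs_with_degrees n d) > 0"
proof -
  have ne: "graphs_with_degrees n d \<noteq> {}" using assms by (simp add: graphical_def)
  then show "card (graphs_with_degrees n d) > 0"
    using finite_graphs_with_degrees by (simp add: card_gt_0_iff)
  show "measure_pmf.prob (random_graph n d) {E. Q E} =
    real (card {G \<in> graphs_with_degrees n d. Q G}) / real (card (graphs_with_degrees n d))"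
    using ne finite_graphs_with_degrees[of n d]
    by (simp add: random_graph_def measure_pmf_of_set Int_def)
qed

lemma prob_asymmetric_eq:
  "measure_pmf.prob (random_graph n d) {E. asymmetric_graph n E} =
    1 - measure_pmf.prob (random_graph n d) {E. symmetric_graph n E}"
proof -
  have "{E. asymmetric_graph n E} = space (random_graph n d) - {E. symmetric_graph n E}"
    by (auto simp: symmetric_graph_def)
  then show ?thesis by (simp only: measure_pmf.prob_compl sets_measure_pmf UNIV_I)
qed

lemma bounded_degree_sequencesD:
  assumes "bounded_degree_sequences \<Delta> N d" "n \<in> N"
  shows "graphical n (d n)" "bounded_degrees n (nat \<lfloor>\<Delta>\<rfloor>) (d n)"
proof -
  show "graphical n (d n)" using assms by (simp add: bounded_degree_sequences_def)
  show "bounded_degrees n (nat \<lfloor>\<Delta>\<rfloor>) (d n)"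
  proof
    fix i assume "i \<in> {1..n}"
    then have "1 \<le> d n i" "real (d n i) \<le> \<Delta>"
      using assms by (auto simp: bounded_degree_sequences_def)
    then show "1 \<le> d n i \<and> d n i \<le> nat \<lfloor>\<Delta>\<rfloor>" by (simp add: le_nat_floor)
  qed
qed

lemma eventually_to_infinity_in:
  "eventually P sequentially \<Longrightarrow> eventually P (to_infinity_in N)"
  "eventually (\<lambda>n. n \<in> N) (to_infinity_in N)"
  by (auto simp: to_infinity_in_def eventually_inf_principal elim: eventually_mono)

lemma tendsto_to_infinity_in: "(f \<longlongrightarrow> l) sequentially \<Longrightarrow> (f \<longlongrightarrow> l) (to_infinity_in N)"
  by (rule tendsto_mono[rotated]) (auto simp: to_infinity_in_def)

lemma sum_index_power_le:
  fixes y :: real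
  assumes "0 \<le> y" "y \<le> 1 / 4"
  shows "(\<Sum>a=1..n. real a * y ^ a) \<le> 4 * y"
proof -
  define z where "z = 2 * y"
  have z: "0 \<le> z" "z \<le> 1 / 2" using assms by (simp_all add: z_def)
  have "(\<Sum>a=1..n. real a * y ^ a) \<le> (\<Sum>a=1..n. z ^ a)"
  proof (rule sum_mono)
    fix a
    \<comment> \<open>Absorbing the factor \<open>a\<close> into \<open>2 ^ a\<close> leaves a
      geometric series of ratio \<open>2 * y \<le> 1 / 2\<close>.\<close>
    have "real a \<le> real (2 ^ a)" unfolding of_nat_le_iff by (rule less_imp_le[OF less_exp])
    then have "real a \<le> 2 ^ a" by simp
    then show "real a * y ^ a \<le> z ^ a"
      using assms by (simp add: z_def power_mult_distrib mult_right_mono)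
  qed
  \<comment> \<open>The subtracted term makes the induction work: the increase of the right side is
    at least the new summand because \<open>z \<le> 1 / 2\<close>.\<close>
  also have "(\<Sum>a=1..n. z ^ a) \<le> 2 * z - 2 * z ^ Suc n"
  proof (induction n)
    case (Suc n)
    have "z * z ^ Suc n \<le> 1 / 2 * z ^ Suc n" using z by (intro mult_right_mono) auto
    then show ?case using Suc by simp
  qed simp
  also have "\<dots> \<le> 4 * y" using z by (simp add: z_def)
  finally show ?thesis .
qed

text \<open>The two hypotheses, together with the vanishing of \<open>1 / sqrt (sqrt n)\<close>,
  make \<open>\<eta>\<close> tend to 0. Hence so does \<open>y\<close>, and a graph is symmetric
  with probability at most \<open>4 * y n\<close>.\<close>

lemma asymmetric_limit:
  assumes "bounded_degree_sequences \<Delta> N d"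
    and n1: "(\<lambda>n. real (degree_count n (d n) 1)) \<in> o[to_infinity_in N](\<lambda>n. sqrt (real n))"
    and n2: "(\<lambda>n. real (degree_count n (d n) 2)) \<in> o[to_infinity_in N](\<lambda>n. real n)"
  shows "((\<lambda>n. measure_pmf.prob (random_graph n (d n)) {E. asymmetric_graph n E}) \<longlongrightarrow> 1) (to_infinity_in N)"
proof -
  let ?F = "to_infinity_in N"
  define D where "D = nat \<lfloor>\<Delta>\<rfloor>"
  define A :: real where "A = 4 * exp 1 * (real (D + 1))\<^sup>2"
  define \<eta> where "\<eta> n = real (degree_count n (d n) 1) / sqrt (real n) +
    real (degree_count n (d n) 2) / real n + 1 / sqrt (sqrt (real n))" for n
  define y where "y n = 2 * exp (3 + A) * A\<^sup>2 * \<eta> n" for n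
  have "((\<lambda>n. 1 / sqrt (sqrt (real n))) \<longlongrightarrow> 0) sequentially" by real_asymp
  then have "((\<lambda>n. 1 / sqrt (sqrt (real n))) \<longlongrightarrow> 0) ?F" by (rule tendsto_to_infinity_in)
  then have "(\<eta> \<longlongrightarrow> 0 + 0 + 0) ?F"
    unfolding \<eta>_def
    by (rule tendsto_add[OF tendsto_add[OF smalloD_tendsto[OF n1] smalloD_tendsto[OF n2]]])
  then have y: "(y \<longlongrightarrow> 0) ?F"
    unfolding y_def by (intro tendsto_mult_right_zero) simp
  have "eventually (\<lambda>n. y n < 1 / 4) ?F" using y by (rule order_tendstoD) simp
  moreover have "eventually (\<lambda>n. real n \<ge> A\<^sup>2) ?F"
    by (rule eventually_to_infinity_in) real_asymp
  moreover note eventually_to_infinity_in(2)[of N]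
  ultimately have low: "eventually (\<lambda>n. 1 - 4 * y n \<le> measure_pmf.prob (random_graph n (d n)) {E. asymmetric_graph n E}) ?F"
  proof eventually_elim
    case (elim n)
    note g = bounded_degree_sequencesD[OF assms(1) elim(3)]
    interpret bounded_degrees n D "d n" using g(2) by (simp add: D_def)
    have y0: "0 \<le> y n" by (simp add: y_def \<eta>_def)
    have "real (card {G \<in> GG. symmetric_graph n G}) \<le> real (card GG) * (\<Sum>a=1..n. real a * y n ^ a)"
      using card_symmetric_le[OF A_def elim(2)] unfolding y_def \<eta>_def .
    also have "\<dots> \<le> real (card GG) * (4 * y n)"
      using y0 elim(1) by (intro mult_left_mono sum_index_power_le) auto
    finally have "measure_pmf.prob (random_graph n (d n)) {E. symmetric_graph n E} \<le> 4 * y n"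
      using prob_random_graph[OF g(1)] by (simp add: divide_le_eq mult.commute)
    then show ?case by (simp add: prob_asymmetric_eq)
  qed
  have "((\<lambda>n. 1 - 4 * y n) \<longlongrightarrow> 1 - 4 * 0) ?F" by (intro tendsto_intros y)
  then have lim: "((\<lambda>n. 1 - 4 * y n) \<longlongrightarrow> 1) ?F" by simp
  show ?thesis
    by (rule tendsto_sandwich[OF low _ lim tendsto_const]) simp
qed

lemma symmetric_limit:
  assumes "bounded_degree_sequences \<Delta> N d"
    and n1: "(\<lambda>n. real (degree_count n (d n) 1)) \<in> \<omega>[to_infinity_in N](\<lambda>n. sqrt (real n))"
  shows "((\<lambda>n. measure_pmf.prob (random_graph n (d n)) {E. symmetric_graph n E}) \<longlongrightarrow> 1) (to_infinity_in N)"
proof -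
  let ?F = "to_infinity_in N"
  define D where "D = nat \<lfloor>\<Delta>\<rfloor>"
  \<comment> \<open>For \<open>n \<ge> 1\<close> and eventually at least \<open>C * sqrt n\<close>
    leaves, their number reaches the threshold of the switching bound; the added 1 ensures that
    \<open>C\<close> and the number of leaves are positive.\<close>
  define C where "C = real (2 * (D + D\<^sup>2) + 1)"
  define y where "y n = sqrt (real n) / real (degree_count n (d n) 1)" for n
  have "(\<lambda>n. sqrt (real n)) \<in> o[?F](\<lambda>n. real (degree_count n (d n) 1))"
    using n1 by (simp add: smallomega_iff_smallo)
  then have y: "(y \<longlongrightarrow> 0) ?F" unfolding y_def by (rule smalloD_tendsto)
  have "eventually (\<lambda>n. norm (real (degree_count n (d n) 1)) \<ge> C * norm (sqrt (real n))) ?F"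
  proof (rule landau_omega.smallD[OF n1])
    show "C > 0" unfolding C_def by (simp only: of_nat_0_less_iff)
  qed
  moreover have "eventually (\<lambda>n. n \<ge> 1) ?F"
    by (rule eventually_to_infinity_in) (rule eventually_ge_at_top)
  moreover note eventually_to_infinity_in(2)[of N]
  ultimately have low: "eventually (\<lambda>n. 1 - 4 * real D * (y n)\<^sup>2 \<le> measure_pmf.prob (random_graph n (d n)) {E. symmetric_graph n E}) ?F"
  proof eventually_elim
    case (elim n)
    note g = bounded_degree_sequencesD[OF assms(1) elim(3)]
    interpret bounded_degrees n D "d n" using g(2) by (simp add: D_def)
    let ?k = "degree_count n (d n) 1"
    have "C * 1 \<le> C * sqrt (real n)" using elim(2) by (intro mult_left_mono) (auto simp: C_def)
    then have "C \<le> real ?k" using elim(1) by simp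
    then have k: "2 * (D + D\<^sup>2) \<le> ?k" "?k > 0" by (simp_all only: C_def of_nat_le_iff)
    have "real (card {G \<in> GG. symmetric_graph n G}) \<le> real (card GG)"
      using card_asymmetric_plus_symmetric by linarith
    then have "(real ?k)\<^sup>2 * real (card {G \<in> GG. asymmetric_graph n G}) \<le> 4 * real D * real n * real (card GG)"
      by (intro order_trans[OF card_asymmetric_leaves[OF k(1)]] mult_left_mono) auto
    then have "measure_pmf.prob (random_graph n (d n)) {E. asymmetric_graph n E} \<le> 4 * real D * real n / (real ?k)\<^sup>2"
      unfolding prob_random_graph(1)[OF g(1)]
      using prob_random_graph(2)[OF g(1)] k(2) by (simp add: field_simps)
    also have "\<dots> = 4 * real D * (y n)\<^sup>2" by (simp add: y_def power_divide)
    finally show ?case by (simp add: prob_asymmetric_eq)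
  qed
  have "((\<lambda>n. 1 - 4 * real D * (y n)\<^sup>2) \<longlongrightarrow> 1 - 4 * real D * 0\<^sup>2) ?F" by (intro tendsto_intros y)
  then have lim: "((\<lambda>n. 1 - 4 * real D * (y n)\<^sup>2) \<longlongrightarrow> 1) ?F" by simp
  show ?thesis
    by (rule tendsto_sandwich[OF low _ lim tendsto_const]) simp
qed

text \<open>The bound \<open>\<delta>\<close> is fixed before \<open>N\<close> and \<open>d\<close>,
  so it depends on \<open>c\<close> and \<open>\<Delta>\<close> alone. Which of the two conditions
  holds may vary with \<open>n\<close>.\<close>

lemma symmetric_lower_bound:
  fixes \<Delta> c :: real
  assumes "c > 0"
  obtains \<delta> :: real where "\<delta> > 0"
    "\<And>N d. bounded_degree_sequences \<Delta> N d \<Longrightarrow>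
      \<forall>n\<in>N. real (degree_count n (d n) 1) > c * sqrt (real n) \<or> real (degree_count n (d n) 2) > c * real n \<Longrightarrow>
      \<forall>\<^sub>F n in to_infinity_in N. measure_pmf.prob (random_graph n (d n)) {E. symmetric_graph n E} > \<delta>"
proof
  define D where "D = nat \<lfloor>\<Delta>\<rfloor>"
  \<comment> \<open>The sum of the bounds on the ratio of asymmetric to symmetric graphs in the two
    cases, hence valid in both. It gives probability at least \<open>1 / (1 + K)\<close>, and
    halving this makes the inequality strict.\<close>
  define K where "K = 4 * real D / c\<^sup>2 + 648 * real D ^ 3 / c ^ 3"
  have K: "K \<ge> 0" using assms by (simp add: K_def)
  show "1 / (2 * (1 + K)) > 0" using K by simp
  fix N :: "nat set" and d :: "nat \<Rightarrow> nat \<Rightarrow> nat"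
  assume bds: "bounded_degree_sequences \<Delta> N d"
    and large: "\<forall>n\<in>N. real (degree_count n (d n) 1) > c * sqrt (real n) \<or> real (degree_count n (d n) 2) > c * real n"
  have "eventually (\<lambda>n. c * sqrt (real n) \<ge> real (2 * (D + D\<^sup>2))) (to_infinity_in N)"
    by (rule eventually_to_infinity_in) (use assms in real_asymp)
  moreover have "eventually (\<lambda>n. c * real n \<ge> real (4 * (D + 1) ^ 3)) (to_infinity_in N)"
    by (rule eventually_to_infinity_in) (use assms in real_asymp)
  moreover have "eventually (\<lambda>n. n \<ge> 1) (to_infinity_in N)"
    by (rule eventually_to_infinity_in) (rule eventually_ge_at_top)
  moreover note eventually_to_infinity_in(2)[of N]
  ultimately show "\<forall>\<^sub>F n in to_infinity_in N. measure_pmf.prob (random_graph n (d n)) {E. symmetric_graph n E} > 1 / (2 * (1 + K))"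
  proof eventually_elim
    case (elim n)
    note g = bounded_degree_sequencesD[OF bds elim(4)]
    interpret bounded_degrees n D "d n" using g(2) by (simp add: D_def)
    define s where "s = real (card {G \<in> GG. symmetric_graph n G})"
    define a where "a = real (card {G \<in> GG. asymmetric_graph n G})"
    have s: "s \<ge> 0" "a \<ge> 0" by (simp_all add: s_def a_def)
    have n0: "real n > 0" using elim(3) by simp
    have "a \<le> K * s"
    proof (cases "real (degree_count n (d n) 1) > c * sqrt (real n)")
      case True
      let ?k = "degree_count n (d n) 1"
      have "real (2 * (D + D\<^sup>2)) \<le> real ?k" using True elim(1) by linarith
      then have k: "2 * (D + D\<^sup>2) \<le> ?k" by (simp only: of_nat_le_iff)
      have "(c * sqrt (real n))\<^sup>2 \<le> (real ?k)\<^sup>2" using True assms by (intro power_mono) auto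
      then have "c\<^sup>2 * real n * a \<le> (real ?k)\<^sup>2 * a"
        using s by (intro mult_right_mono) (simp_all add: power_mult_distrib)
      also have "\<dots> \<le> 4 * real D * real n * s"
        using card_asymmetric_leaves[OF k] by (simp add: s_def a_def)
      finally have "a \<le> 4 * real D / c\<^sup>2 * s" using n0 assms by (simp add: field_simps)
      also have "\<dots> \<le> K * s" using s assms by (intro mult_right_mono) (auto simp: K_def)
      finally show ?thesis .
    next
      case False
      let ?k = "degree_count n (d n) 2"
      have kc: "real ?k > c * real n" using False large elim(4) by blast
      have "real (4 * (D + 1) ^ 3) \<le> real ?k" using kc elim(2) by linarith
      then have k: "4 * (D + 1) ^ 3 \<le> ?k" by (simp only: of_nat_le_iff)
      have "(c * real n) ^ 3 \<le> real ?k ^ 3" using kc assms by (intro power_mono) auto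
      then have "c ^ 3 * real n ^ 3 * a \<le> real ?k ^ 3 * a"
        using s by (intro mult_right_mono) (simp_all add: power_mult_distrib)
      also have "\<dots> \<le> 648 * real D ^ 3 * real n ^ 3 * s"
        using card_asymmetric_triangles[OF k] by (simp add: s_def a_def)
      finally have "a \<le> 648 * real D ^ 3 / c ^ 3 * s" using n0 assms by (simp add: field_simps)
      also have "\<dots> \<le> K * s" using s assms by (intro mult_right_mono) (auto simp: K_def)
      finally show ?thesis .
    qed
    then have "real (card GG) \<le> (1 + K) * s"
      using card_asymmetric_plus_symmetric by (simp add: s_def a_def algebra_simps flip: of_nat_add)
    moreover note pos = prob_random_graph(2)[OF g(1)]
    ultimately have "1 / (1 + K) \<le> s / real (card GG)" using K by (simp add: field_simps)
    moreover have "1 / (2 * (1 + K)) < 1 / (1 + K)" using K by (simp add: field_simps)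
    ultimately show ?case using prob_random_graph(1)[OF g(1)] by (simp add: s_def)
  qed
qed

theorem theorem1p2:
  fixes \<Delta> :: real
  assumes "\<Delta> > 0"
  shows
    "(\<forall>(N :: nat set) (d :: nat \<Rightarrow> nat \<Rightarrow> nat).
        bounded_degree_sequences \<Delta> N d \<longrightarrow>
        (\<lambda>n. real (degree_count n (d n) 1)) \<in> o[to_infinity_in N](\<lambda>n. sqrt (real n)) \<longrightarrow>
        (\<lambda>n. real (degree_count n (d n) 2)) \<in> o[to_infinity_in N](\<lambda>n. real n) \<longrightarrow>
        ((\<lambda>n. measure_pmf.prob (random_graph n (d n)) {E. asymmetric_graph n E}) \<longlongrightarrow> 1)
          (to_infinity_in N)) \<and>
     (\<forall>(N :: nat set) (d :: nat \<Rightarrow> nat \<Rightarrow> nat).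
        bounded_degree_sequences \<Delta> N d \<longrightarrow>
        (\<lambda>n. real (degree_count n (d n) 1)) \<in> \<omega>[to_infinity_in N](\<lambda>n. sqrt (real n)) \<longrightarrow>
        ((\<lambda>n. measure_pmf.prob (random_graph n (d n)) {E. symmetric_graph n E}) \<longlongrightarrow> 1)
          (to_infinity_in N)) \<and>
     (\<forall>c::real. c > 0 \<longrightarrow>
        (\<exists>\<delta>::real. \<delta> > 0 \<and>
          (\<forall>(N :: nat set) (d :: nat \<Rightarrow> nat \<Rightarrow> nat).
             bounded_degree_sequences \<Delta> N d \<longrightarrow>
             (\<forall>n\<in>N. real (degree_count n (d n) 1) > c * sqrt (real n) \<or>
                     real (degree_count n (d n) 2) > c * real n) \<longrightarrow>
             (\<forall>\<^sub>F n in to_infinity_in N.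
                measure_pmf.prob (random_graph n (d n)) {E. symmetric_graph n E} > \<delta>))))"
proof (intro conjI allI impI)
  fix c :: real
  assume "c > 0"
  then obtain \<delta> :: real where "\<delta> > 0"
    "\<And>N d. bounded_degree_sequences \<Delta> N d \<Longrightarrow>
      \<forall>n\<in>N. real (degree_count n (d n) 1) > c * sqrt (real n) \<or> real (degree_count n (d n) 2) > c * real n \<Longrightarrow>
      \<forall>\<^sub>F n in to_infinity_in N. measure_pmf.prob (random_graph n (d n)) {E. symmetric_graph n E} > \<delta>"
    using symmetric_lower_bound[of c \<Delta>] by blast
  then show "\<exists>\<delta>::real. \<delta> > 0 \<and>
          (\<forall>(N :: nat set) (d :: nat \<Rightarrow> nat \<Rightarrow> nat).
             bounded_degree_sequences \<Delta> N d \<longrightarrow>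
             (\<forall>n\<in>N. real (degree_count n (d n) 1) > c * sqrt (real n) \<or>
                     real (degree_count n (d n) 2) > c * real n) \<longrightarrow>
             (\<forall>\<^sub>F n in to_infinity_in N.
                measure_pmf.prob (random_graph n (d n)) {E. symmetric_graph n E} > \<delta>))"
    by blast
qed (simp_all add: asymmetric_limit symmetric_limit)

end
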